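(* Let $n$, $c$, $s$ be fixed integers with $n,c\ge 2$ and $1\le s\le c-1$. Let $t=\lceil sn/c\rceil$ and let $\lambda\in[c]$ be the integer with $\lambda\equiv sn\pmod{c}$. Then \[\lim_{q\to\infty} f^q_{c,s}(n)\big/ q^t=\frac{\binom{n}{t}}{\binom{n}{t}-m(n,t,\lambda;s+1,c-s+1)}.\]
   Context: For a positive integer $m$, $[m]=\{1,\dots,m\}$. A code $\mathcal{C}\subseteq[q]^n$ is $(c,s)$-frameproof if for every $c+1$ codewords $\bm x^0,\bm x^1,\dots,\bm x^c\in\mathcal{C}$ with $\bm x^0\neq\bm x^j$ for each $j\in[c]$ (where $\bm x^1,\dots,\bm x^c$ need not be distinct), there is some coordinate $i\in[n]$ with $|\{j\in[c]: x^j_i=x^0_i\}|<s$. $f^q_{c,s}(n)$ denotes the maximum size of a $(c,s)$-frameproof code in $[q]^n$. A sequence $A_1,\dots,A_\lambda$ of subsets of $[n]$ (repetitions allowed) is $k_1$-disjoint if $\bigcap_{i\in B}A_i=\emptyset$ for every $k_1$-subset $B\subseteq[\lambda]$ (vacuous if $k_1>\lambda$); it is $k_2$-covering if $\bigcup_{i\in B}A_i=[n]$ for every $k_2$-subset $B\subseteq[\lambda]$ (vacuous if $k_2>\lambda$); it is $(k_1,k_2)$-disjoint if both hold. The generalized matching number $m(n,t,\lambda;k_1,k_2)$ is the maximum size of a family $\mathcal{F}$ of $t$-subsets of $[n]$ such that there are no $A_1,\dots,A_\lambda\in\mathcal{F}$ (not necessarily distinct) forming a $(k_1,k_2)$-disjoint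 sequence. *)

theory Defs
  imports Complex_Main "HOL-Library.FuncSet" "HOL-Number_Theory.Cong"
begin

(* A word of length n over the alphabet {1..q} is an extensional function on {1..n}. *)
definition words :: "nat \<Rightarrow> nat \<Rightarrow> (nat \<Rightarrow> nat) set" where
  "words q n = {1..n} \<rightarrow>\<^sub>E {1..q}"

(* x 0, x 1, ..., x c are the codewords; x 1, ..., x c may repeat. *)
definition frameproof :: "nat \<Rightarrow> nat \<Rightarrow> nat \<Rightarrow> (nat \<Rightarrow> nat) set \<Rightarrow> bool" where
  "frameproof c s n C \<longleftrightarrow>
     (\<forall>x :: nat \<Rightarrow> nat \<Rightarrow> nat.
        (\<forall>j\<in>{0..c}. x j \<in> C) \<and> (\<forall>j\<in>{1..c}. x 0 \<noteq> x j) \<longrightarrow>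
        (\<exists>i\<in>{1..n}. card {j\<in>{1..c}. x j i = x 0 i} < s))"

definition max_frameproof :: "nat \<Rightarrow> nat \<Rightarrow> nat \<Rightarrow> nat \<Rightarrow> nat" where
  "max_frameproof q c s n = Max {card C | C. C \<subseteq> words q n \<and> frameproof c s n C}"

definition disjoint_seq :: "nat \<Rightarrow> nat \<Rightarrow> (nat \<Rightarrow> nat set) \<Rightarrow> bool" where
  "disjoint_seq l k1 A \<longleftrightarrow> (\<forall>B. B \<subseteq> {1..l} \<and> card B = k1 \<longrightarrow> (\<Inter>i\<in>B. A i) = {})"

definition covering_seq :: "nat \<Rightarrow> nat \<Rightarrow> nat \<Rightarrow> (nat \<Rightarrow> nat set) \<Rightarrow> bool" where
  "covering_seq n l k2 A \<longleftrightarrow> (\<forall>B. B \<subseteq> {1..l} \<and> card B = k2 \<longrightarrow> (\<Union>i\<in>B. A i) = {1..n})"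

(* Only the values A 1, ..., A l matter; they are meant to be subsets of {1..n}. *)
definition disjoint_covering_seq ::
    "nat \<Rightarrow> nat \<Rightarrow> nat \<Rightarrow> nat \<Rightarrow> (nat \<Rightarrow> nat set) \<Rightarrow> bool" where
  "disjoint_covering_seq n l k1 k2 A \<longleftrightarrow> disjoint_seq l k1 A \<and> covering_seq n l k2 A"

definition matching_free ::
    "nat \<Rightarrow> nat \<Rightarrow> nat \<Rightarrow> nat \<Rightarrow> nat set set \<Rightarrow> bool" where
  "matching_free n l k1 k2 F \<longleftrightarrow>
     \<not> (\<exists>A. (\<forall>i\<in>{1..l}. A i \<in> F) \<and> disjoint_covering_seq n l k1 k2 A)"

(* For l >= 1 the empty family is matching-free, so the maximum is over a nonempty finite set. *)
definition gen_matching_number :: "nat \<Rightarrow> nat \<Rightarrow> nat \<Rightarrow> nat \<Rightarrow> nat \<Rightarrow> nat" where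
  "gen_matching_number n t l k1 k2 =
     Max {card F | F. F \<subseteq> {A. A \<subseteq> {1..n} \<and> card A = t} \<and> matching_free n l k1 k2 F}"

end

(*
  Upper bound. Call a t-set T own for a codeword x if no other codeword agrees with x on T.
  At most O(q^(t-1)) codewords have an own (t-1)-set. For any other x, the t-sets that are not
  own form a matching-free family: a disjoint covering sequence of length l in it could be completed
  by c-l sets of size t-1 to c sets covering every coordinate exactly s times, and the c
  corresponding codewords would violate frameproofness. So x has at least (n choose t) - m own
  t-sets, while each t-set is own for at most q^t codewords.

  Lower bound. Let F be an optimal matching-free family. It suffices to find many words, each with a
  permutation pi, such that two distinct words agree in at most t coordinates, and agreement sets of
  size t lie in pi(F). Instead of a nibble argument, such words are constructed algebraically.
  The symbol at coordinate i is a vector of residues mod p indexed by the t-sets T, and the label of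
  a word at T is the sum of its T-entries over i in T. Words of type pi have label 0 at
  T in pi(F) and, at all other T, labels in an interval reserved for pi, all with the same
  offset z. Hence agreement on T outside pi(F) forces equal types and equal offsets, so that the
  difference of the two words lies in a small linear space; one linear hash injective on all these spaces
  separates them. The label 0 has density 1/p only, so almost all patterns get used.
  Fixing p and attaching an MDS code over Z/N with N = 1 mod n! yields all large q.
*)

theory Submission
  imports Defs "HOL-Combinatorics.Permutations" "HOL-Computational_Algebra.Polynomial"
begin

section \<open>Degree sequences and generalized matchings\<close>

text \<open>Why the construction meets the bound: put k = (n choose t), so that there are p^k
  symbols. Fixing all labels leaves p^(k*n-k) words. Equal symbols on a t-set S leave k*(n-t) free
  entries in a difference, and equal labels remove k-1 more, the label at S being settled already.
  The resulting dimension e is the number of hash components. As k*n-k = k*t+e-1, a label pattern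
  keeps about p^(k*t-1) words per hash value. If each t-set is own for R of the n! types, the
  nonzero labels split into R intervals of length about p/R, and n! types give about (n!/R)*p^(k*t)
  words. Using all permutations makes R the same for every t-set, with R*(n choose t) = n!*((n
  choose t)-m), which is the claimed ratio. The common offset matters: with independent labels,
  agreement on one t-set would say nothing about the other labels, and the space of differences
  would outgrow e. Different types may receive different hash values, so linearity does not separate
  them; words of different types agreeing in t+1 coordinates are deleted instead, at the cost of a
  fraction O(1/p).\<close>

lemma sum_card_eq_sum_degree:
  assumes "finite I" "finite J" "\<And>j. j \<in> J \<Longrightarrow> A j \<subseteq> I"
  shows "(\<Sum>j\<in>J. card (A j)) = (\<Sum>i\<in>I. card {j\<in>J. i \<in> A j})"
proof -
  have "(\<Sum>j\<in>J. card (A j)) = (\<Sum>j\<in>J. \<Sum>i\<in>I. if i \<in> A j then 1 else 0)"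
  proof (rule sum.cong)
    fix j assume "j \<in> J"
    then have "{i \<in> I. i \<in> A j} = A j" using assms(3) by auto
    then show "card (A j) = (\<Sum>i\<in>I. if i \<in> A j then 1 else 0)"
      using assms(1) by (simp add: sum.If_cases Int_def)
  qed simp
  also have "\<dots> = (\<Sum>i\<in>I. \<Sum>j\<in>J. if i \<in> A j then 1 else 0)" by (rule sum.swap)
  also have "\<dots> = (\<Sum>i\<in>I. card {j\<in>J. i \<in> A j})"
    using assms(2) by (simp add: sum.If_cases Int_def)
  finally show ?thesis .
qed

text \<open>Greedy choice of one set at a time: it must contain every point whose remaining degree
  equals the number of sets left, and only points of positive degree. Comparing both kinds of points
  with the degree sum shows that a set of the prescribed size fits in between. Allowing
  \<open>b = r\<close> keeps the hypothesis stable when \<open>r\<close> decreases.\<close>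

lemma degree_sequence_realization:
  fixes d :: "'a \<Rightarrow> nat"
  assumes "finite I" "\<And>i. i \<in> I \<Longrightarrow> d i \<le> r" "(\<Sum>i\<in>I. d i) = r * a + b" "b \<le> r"
  shows "\<exists>A. (\<forall>j<r. A j \<subseteq> I \<and> card (A j) = (if j < b then a + 1 else a)) \<and>
             (\<forall>i\<in>I. card {j. j < r \<and> i \<in> A j} = d i)"
  using assms(2-4)
proof (induction r arbitrary: d b)
  case 0
  then show ?case by simp
next
  case (Suc r)
  \<comment> \<open>The larger sets come first, so the set chosen now has size \<open>a + 1\<close>
    as long as \<open>b\<close> is positive. The truncated \<open>b - 1\<close> is then the right
    remainder in both cases.\<close>
  define e where "e = (if b = 0 then a else a + 1)"
  let ?X = "{i\<in>I. d i = Suc r}" and ?Y = "{i\<in>I. d i \<ge> 1}"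
  have "Suc r * card ?X = (\<Sum>i\<in>?X. d i)" by simp
  also have "\<dots> \<le> (\<Sum>i\<in>I. d i)" using assms(1) by (intro sum_mono2) auto
  finally have "Suc r * card ?X \<le> Suc r * a + b" using Suc.prems by simp
  then have "Suc r * card ?X \<le> Suc r * e" using Suc.prems(3)
    by (auto simp: e_def algebra_simps)
  then have X: "card ?X \<le> e" by (rule mult_left_le_imp_le) simp
  have "(\<Sum>i\<in>I. d i) = (\<Sum>i\<in>?Y. d i)"
    using assms(1) by (intro sum.mono_neutral_right) auto
  also have "\<dots> \<le> (\<Sum>i\<in>?Y. Suc r)" using Suc.prems(1) by (intro sum_mono) auto
  finally have Y0: "Suc r * a + b \<le> Suc r * card ?Y" using Suc.prems by (simp add: algebra_simps)
  have Y: "e \<le> card ?Y"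
  proof (rule ccontr)
    assume "\<not> e \<le> card ?Y"
    then have Ye: "card ?Y < e" by linarith
    show False
    proof (cases "b = 0")
      case True
      then have "Suc r * card ?Y < Suc r * a" using Ye by (intro mult_strict_left_mono) (auto simp: e_def)
      then show False using Y0 True by linarith
    next
      case False
      then have "Suc r * card ?Y \<le> Suc r * a" using Ye by (intro mult_le_mono2) (auto simp: e_def)
      then show False using Y0 False by linarith
    qed
  qed
  have "?X \<subseteq> ?Y" "finite ?Y" using assms(1) by auto
  then obtain E where E: "?X \<subseteq> E" "E \<subseteq> ?Y" "card E = e"
    using exists_subset_between[OF X Y] by metis
  have EI: "E \<subseteq> I" using E(2) by blast
  then have "finite E" using assms(1) by (rule finite_subset)
  define d' where "d' i = (if i \<in> E then d i - 1 else d i)" for i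
  have "(\<Sum>i\<in>I. d i) = (\<Sum>i\<in>I. d' i + (if i \<in> E then 1 else 0))"
  proof (rule sum.cong)
    fix i assume "i \<in> I"
    then show "d i = d' i + (if i \<in> E then 1 else 0)" using E(2) by (auto simp: d'_def)
  qed simp
  also have "\<dots> = (\<Sum>i\<in>I. d' i) + e"
    using EI E(3) \<open>finite E\<close> assms(1) by (simp add: sum.distrib sum.If_cases Int_absorb1)
  finally have "(\<Sum>i\<in>I. d' i) = r * a + (b - 1)"
    using Suc.prems by (auto simp: e_def split: if_splits)
  moreover have "d' i \<le> r" if "i \<in> I" for i
  proof (cases "d i = Suc r")
    case True
    then have "i \<in> E" using E(1) that by blast
    then show ?thesis using True by (simp add: d'_def)
  next
    case False
    then have "d i \<le> r" using Suc.prems(1)[OF that] by linarith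
    then show ?thesis by (rule order_trans[rotated]) (simp add: d'_def)
  qed
  moreover have "b - 1 \<le> r" using Suc.prems by simp
  ultimately obtain A where A: "\<forall>j<r. A j \<subseteq> I \<and> card (A j) = (if j < b - 1 then a + 1 else a)"
    "\<forall>i\<in>I. card {j. j < r \<and> i \<in> A j} = d' i"
    using Suc.IH[of d' "b - 1"] by blast
  define A' where "A' = case_nat E A"
  have "A' j \<subseteq> I \<and> card (A' j) = (if j < b then a + 1 else a)" if "j < Suc r" for j
  proof (cases j)
    case 0
    then show ?thesis using E(3) EI by (simp add: A'_def e_def)
  next
    case (Suc j')
    then have "j' < r" using that by simp
    then have "A j' \<subseteq> I" "card (A j') = (if j' < b - 1 then a + 1 else a)" using A(1) by blast+
    then show ?thesis using Suc by (simp add: A'_def less_diff_conv)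
  qed
  moreover have "card {j. j < Suc r \<and> i \<in> A' j} = d i" if "i \<in> I" for i
  proof -
    have "{j. j < Suc r \<and> i \<in> A' j} = (if i \<in> E then {0} else {}) \<union> Suc ` {j. j < r \<and> i \<in> A j}"
    proof (rule set_eqI)
      fix j show "j \<in> {j. j < Suc r \<and> i \<in> A' j} \<longleftrightarrow>
          j \<in> (if i \<in> E then {0} else {}) \<union> Suc ` {j. j < r \<and> i \<in> A j}"
        by (cases j) (auto simp: A'_def)
    qed
    then have "card {j. j < Suc r \<and> i \<in> A' j} = (if i \<in> E then 1 else 0) + card {j. j < r \<and> i \<in> A j}"
      by (auto simp: card_image card_insert_if)
    then show ?thesis using A(2) that E(2) by (auto simp: d'_def)
  qed
  ultimately show ?case by blast
qed

text \<open>No point lies in more than s of the c sets, and a point missed by c-s+1 of them would be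
  covered at most s-1 times. Injectivity of \<open>\<tau>\<close> is all that these counts ask of
  the selection, so any l of the c sets may be taken.\<close>

lemma disjoint_covering_seq_of_exact_cover:
  assumes "\<And>j. j \<in> {1..c} \<Longrightarrow> A j \<subseteq> {1..n}"
    and deg: "\<And>i. i \<in> {1..n} \<Longrightarrow> card {j\<in>{1..c}. i \<in> A j} = s"
    and s: "1 \<le> s" "s \<le> c" and \<tau>: "inj_on \<tau> {1..l}" "\<tau> ` {1..l} \<subseteq> {1..c}"
  shows "disjoint_covering_seq n l (s + 1) (c - s + 1) (A \<circ> \<tau>)"
  unfolding disjoint_covering_seq_def disjoint_seq_def covering_seq_def
proof (intro conjI allI impI; elim conjE)
  fix B assume B: "B \<subseteq> {1..l}" "card B = s + 1"
  have cB: "card (\<tau> ` B) = s + 1"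
    using B \<tau>(1) by (metis card_image inj_on_subset)
  show "(\<Inter>i\<in>B. (A \<circ> \<tau>) i) = {}"
  proof (rule ccontr)
    assume "\<not> ?thesis"
    then obtain x where x: "\<forall>i\<in>B. x \<in> A (\<tau> i)" by auto
    from B obtain b where "b \<in> B" by fastforce
    then have "x \<in> {1..n}" using x assms(1)[of "\<tau> b"] \<tau>(2) B(1) by blast
    moreover have "card (\<tau> ` B) \<le> card {j\<in>{1..c}. x \<in> A j}"
      using x subset_trans[OF image_mono[OF B(1), of \<tau>] \<tau>(2)] by (intro card_mono) auto
    ultimately show False using deg cB by simp
  qed
next
  fix B assume B: "B \<subseteq> {1..l}" "card B = c - s + 1"
  have cB: "card (\<tau> ` B) = c - s + 1"
    using B \<tau>(1) by (metis card_image inj_on_subset)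
  show "(\<Union>i\<in>B. (A \<circ> \<tau>) i) = {1..n}"
  proof (rule subset_antisym)
    show "(\<Union>i\<in>B. (A \<circ> \<tau>) i) \<subseteq> {1..n}"
    proof (rule UN_least)
      fix i assume "i \<in> B"
      then have "\<tau> i \<in> {1..c}" using B(1) \<tau>(2) by blast
      then show "(A \<circ> \<tau>) i \<subseteq> {1..n}" using assms(1) by simp
    qed
    show "{1..n} \<subseteq> (\<Union>i\<in>B. (A \<circ> \<tau>) i)"
    proof (rule ccontr)
      assume "\<not> {1..n} \<subseteq> (\<Union>i\<in>B. (A \<circ> \<tau>) i)"
      then obtain x where x: "x \<in> {1..n}" "\<forall>i\<in>B. x \<notin> A (\<tau> i)" by force
      then have "card {j\<in>{1..c}. x \<in> A j} \<le> card ({1..c} - \<tau> ` B)"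
        by (intro card_mono) auto
      also have "\<dots> = c - (c - s + 1)"
        using subset_trans[OF image_mono[OF B(1), of \<tau>] \<tau>(2)] cB
        by (subst card_Diff_subset) (auto intro: card_ge_0_finite)
      finally show False using deg x s by simp
    qed
  qed
qed

section \<open>Attainment of both maxima and positivity of the denominator\<close>

abbreviation ksets :: "nat \<Rightarrow> nat \<Rightarrow> nat set set" where
  "ksets n t \<equiv> {A. A \<subseteq> {1..n} \<and> card A = t}"

lemma finite_ksets: "finite (ksets n t)"
  by (rule finite_subset[of _ "Pow {1..n}"]) auto

lemma card_ksets: "card (ksets n t) = n choose t"
  using n_subsets[of "{1..n}" t] by simp

lemma gen_matching_number_ge:
  assumes "F \<subseteq> ksets n t" "matching_free n l k1 k2 F"
  shows "card F \<le> gen_matching_number n t l k1 k2"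
  unfolding gen_matching_number_def
proof (rule Max_ge)
  show "finite {card F | F. F \<subseteq> ksets n t \<and> matching_free n l k1 k2 F}"
    by (rule finite_subset[of _ "card ` Pow (ksets n t)"]) (auto simp: finite_ksets)
qed (use assms in auto)

lemma gen_matching_number_attained:
  assumes "l \<ge> 1"
  obtains F where "F \<subseteq> ksets n t" "matching_free n l k1 k2 F"
    "card F = gen_matching_number n t l k1 k2"
proof -
  let ?S = "{card F | F. F \<subseteq> ksets n t \<and> matching_free n l k1 k2 F}"
  have "finite ?S"
    by (rule finite_subset[of _ "card ` Pow (ksets n t)"]) (auto simp: finite_ksets)
  moreover have "matching_free n l k1 k2 {}"
    using assms by (auto simp: matching_free_def)
  then have "?S \<noteq> {}" by blast
  ultimately have "Max ?S \<in> ?S" by (rule Max_in)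
  then show ?thesis using that unfolding gen_matching_number_def by auto
qed

text \<open>Keeps the denominator of the limit nonzero. The constant degree s is realized by l sets
  of size t and c-l sets of size t-1; the large ones form a forbidden sequence, so the family of all
  t-sets is not matching-free.\<close>

lemma gen_matching_number_less:
  assumes "1 \<le> s" "s \<le> c" "s * n = c * (t - 1) + l" "l \<in> {1..c}" "t \<ge> 1"
  shows "gen_matching_number n t l (s + 1) (c - s + 1) < n choose t"
proof -
  have "(\<Sum>i\<in>{1..n}. s) = c * (t - 1) + l" using assms(3) by (simp add: mult.commute)
  then obtain A where A: "\<forall>j<c. A j \<subseteq> {1..n} \<and> card (A j) = (if j < l then t - 1 + 1 else t - 1)"
     "\<forall>i\<in>{1..n}. card {j. j < c \<and> i \<in> A j} = s"
    using degree_sequence_realization[of "{1..n}" "\<lambda>_. s" c "t - 1" l] assms by auto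
  define A' where "A' j = A (j - 1)" for j
  have A': "A' j \<subseteq> {1..n}" if "j \<in> {1..c}" for j
    using A(1)[rule_format, of "j - 1"] that by (cases j) (simp_all add: A'_def)
  have deg: "card {j\<in>{1..c}. i \<in> A' j} = s" if "i \<in> {1..n}" for i
  proof -
    have "{j\<in>{1..c}. i \<in> A' j} = Suc ` {j. j < c \<and> i \<in> A j}"
    proof (rule set_eqI)
      fix j show "j \<in> {j\<in>{1..c}. i \<in> A' j} \<longleftrightarrow> j \<in> Suc ` {j. j < c \<and> i \<in> A j}"
        by (cases j) (auto simp: A'_def)
    qed
    then show ?thesis using A(2) that by (simp add: card_image)
  qed
  have "disjoint_covering_seq n l (s + 1) (c - s + 1) (A' \<circ> id)"
    using A' deg assms by (intro disjoint_covering_seq_of_exact_cover) auto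
  moreover have "\<forall>i\<in>{1..l}. A' i \<in> ksets n t"
  proof
    fix i assume i: "i \<in> {1..l}"
    then have "i - 1 < c" "i - 1 < l" using assms by auto
    then show "A' i \<in> ksets n t" using A(1) assms unfolding A'_def by simp
  qed
  ultimately have nf: "\<not> matching_free n l (s + 1) (c - s + 1) (ksets n t)"
    unfolding matching_free_def comp_id by blast
  have "l \<ge> 1" using assms(4) by simp
  obtain F where F: "F \<subseteq> ksets n t" "matching_free n l (s + 1) (c - s + 1) F"
    "card F = gen_matching_number n t l (s + 1) (c - s + 1)"
    using gen_matching_number_attained[OF \<open>l \<ge> 1\<close>] .
  then have "F \<subset> ksets n t" using nf by auto
  then have "card F < card (ksets n t)" by (intro psubset_card_mono finite_ksets)
  then show ?thesis using F card_ksets by simp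
qed

lemma finite_words: "finite (words q n)"
  by (simp add: words_def finite_PiE)

lemma max_frameproof_ge:
  assumes "C \<subseteq> words q n" "frameproof c s n C"
  shows "card C \<le> max_frameproof q c s n"
  unfolding max_frameproof_def
proof (rule Max_ge)
  show "finite {card C | C. C \<subseteq> words q n \<and> frameproof c s n C}"
    by (rule finite_subset[of _ "card ` Pow (words q n)"]) (auto simp: finite_words)
qed (use assms in auto)

lemma max_frameproof_attained:
  obtains C where "C \<subseteq> words q n" "frameproof c s n C" "card C = max_frameproof q c s n"
proof -
  let ?S = "{card C | C. C \<subseteq> words q n \<and> frameproof c s n C}"
  have "finite ?S"
    by (rule finite_subset[of _ "card ` Pow (words q n)"]) (auto simp: finite_words)
  moreover have "frameproof c s n {}" by (auto simp: frameproof_def)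
  then have "?S \<noteq> {}" by blast
  ultimately have "Max ?S \<in> ?S" by (rule Max_in)
  then show ?thesis using that unfolding max_frameproof_def by auto
qed

section \<open>The upper bound\<close>

definition own :: "(nat \<Rightarrow> nat) set \<Rightarrow> (nat \<Rightarrow> nat) \<Rightarrow> nat set \<Rightarrow> bool" where
  "own C x T \<longleftrightarrow> (\<forall>y\<in>C. (\<forall>i\<in>T. y i = x i) \<longrightarrow> y = x)"

lemma card_own_le:
  assumes "C \<subseteq> words q n" "T \<subseteq> {1..n}"
  shows "card {x\<in>C. own C x T} \<le> q ^ card T"
proof -
  have fT: "finite T" using assms(2) finite_subset by auto
  have "inj_on (\<lambda>x. restrict x T) {x\<in>C. own C x T}"
  proof (rule inj_onI)
    fix x y assume xy: "x \<in> {x\<in>C. own C x T}" "y \<in> {x\<in>C. own C x T}" "restrict x T = restrict y T"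
    then have "\<forall>i\<in>T. y i = x i" by (metis restrict_apply')
    then show "x = y" using xy by (auto simp: own_def)
  qed
  moreover have "(\<lambda>x. restrict x T) ` {x\<in>C. own C x T} \<subseteq> T \<rightarrow>\<^sub>E {1..q}"
  proof (rule image_subsetI)
    fix x assume "x \<in> {x\<in>C. own C x T}"
    then have "x \<in> {1..n} \<rightarrow> {1..q}" using assms(1) by (auto simp: words_def PiE_iff)
    then have "x i \<in> {1..q}" if "i \<in> T" for i using that assms(2) by (meson PiE subsetD Pi_mem)
    then show "restrict x T \<in> T \<rightarrow>\<^sub>E {1..q}" by simp
  qed
  moreover have "finite (T \<rightarrow>\<^sub>E {1..q})" using fT by (simp add: finite_PiE)
  ultimately have "card {x\<in>C. own C x T} \<le> card (T \<rightarrow>\<^sub>E {1..q})" by (rule card_inj_on_le)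
  then show ?thesis using fT by (simp add: card_PiE)
qed

text \<open>The completion exists because disjointness bounds each degree by s from above and
  covering bounds it by s-(c-l) from below. The missing multiplicity of every point thus lies
  between 0 and c-l, as \<open>degree_sequence_realization\<close> requires. By \<open>no\<close>,
  the completing sets also admit codewords other than x.\<close>

lemma matching_free_not_own:
  assumes C: "frameproof c s n C" "x \<in> C"
    and no: "\<And>S. S \<in> ksets n (t - 1) \<Longrightarrow> \<not> own C x S"
    and par: "s * n = c * (t - 1) + l" "1 \<le> s" "s \<le> c" "l \<in> {1..c}" "t \<ge> 1"
  shows "matching_free n l (s + 1) (c - s + 1) {T \<in> ksets n t. \<not> own C x T}"
  unfolding matching_free_def
proof
  assume "\<exists>A. (\<forall>i\<in>{1..l}. A i \<in> {T \<in> ksets n t. \<not> own C x T}) \<and>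
    disjoint_covering_seq n l (s + 1) (c - s + 1) A"
  then obtain A where A0: "\<forall>i\<in>{1..l}. A i \<in> {T \<in> ksets n t. \<not> own C x T}"
    "disjoint_covering_seq n l (s + 1) (c - s + 1) A" by (elim exE conjE)
  then have A: "A j \<subseteq> {1..n} \<and> card (A j) = t \<and> \<not> own C x (A j)" if "j \<in> {1..l}" for j
    using that by blast
  have dis: "B \<subseteq> {1..l} \<Longrightarrow> card B = s + 1 \<Longrightarrow> (\<Inter>i\<in>B. A i) = {}"
    and cov: "B \<subseteq> {1..l} \<Longrightarrow> card B = c - s + 1 \<Longrightarrow> (\<Union>i\<in>B. A i) = {1..n}" for B
    using A0(2) unfolding disjoint_covering_seq_def disjoint_seq_def covering_seq_def by simp_all
  define deg where "deg i = card {j\<in>{1..l}. i \<in> A j}" for i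
  have deg_le: "deg i \<le> s" for i
  proof (rule ccontr)
    assume "\<not> deg i \<le> s"
    then have "s + 1 \<le> card {j\<in>{1..l}. i \<in> A j}" by (simp add: deg_def)
    then obtain B where "B \<subseteq> {j\<in>{1..l}. i \<in> A j}" "card B = s + 1"
      by (meson obtain_subset_with_card_n)
    then show False using dis[of B] by blast
  qed
  have deg_ge: "s \<le> deg i + (c - l)" if "i \<in> {1..n}" for i
  proof (rule ccontr)
    assume a: "\<not> ?thesis"
    have "card ({1..l} - {j\<in>{1..l}. i \<in> A j}) = card {1..l} - card {j\<in>{1..l}. i \<in> A j}"
      by (rule card_Diff_subset) auto
    moreover have "{1..l} - {j\<in>{1..l}. i \<in> A j} = {j\<in>{1..l}. i \<notin> A j}" by blast
    ultimately have "card {j\<in>{1..l}. i \<notin> A j} = l - deg i" by (simp add: deg_def)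
    then have "c - s + 1 \<le> card {j\<in>{1..l}. i \<notin> A j}" using a par by auto
    then obtain B where "B \<subseteq> {j\<in>{1..l}. i \<notin> A j}" "card B = c - s + 1"
      by (meson obtain_subset_with_card_n)
    then show False using cov[of B] that by blast
  qed
  have "(\<Sum>i\<in>{1..n}. s - deg i) + (\<Sum>i\<in>{1..n}. deg i) = s * n"
    using deg_le by (simp add: sum.distrib[symmetric])
  moreover have "(\<Sum>i\<in>{1..n}. deg i) = l * t"
    unfolding deg_def using A by (subst sum_card_eq_sum_degree[symmetric]) auto
  moreover have "s * n = (c - l) * (t - 1) + l * t"
  proof -
    obtain c' t' where "c = l + c'" "t = Suc t'"
      using par by (metis atLeastAtMost_iff le_Suc_ex not0_implies_Suc not_one_le_zero)
    then show ?thesis using par(1) by (simp add: algebra_simps)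
  qed
  ultimately have "(\<Sum>i\<in>{1..n}. s - deg i) = (c - l) * (t - 1) + 0" by simp
  moreover have "s - deg i \<le> c - l" if "i \<in> {1..n}" for i
    using deg_ge[OF that] by linarith
  \<comment> \<open>The total deficiency is exactly (c-l)(t-1), so the realization is used with
    remainder 0 and every completing set gets size \<open>t - 1\<close>.\<close>
  ultimately obtain B where B: "\<forall>j<c - l. B j \<subseteq> {1..n} \<and> card (B j) = (if j < 0 then t - 1 + 1 else t - 1)"
     "\<forall>i\<in>{1..n}. card {j. j < c - l \<and> i \<in> B j} = s - deg i"
    using degree_sequence_realization[of "{1..n}" "\<lambda>i. s - deg i" "c - l" "t - 1" 0] by auto
  define D where "D j = (if j \<le> l then A j else B (j - l - 1))" for j
  have "\<exists>y. y \<in> C \<and> y \<noteq> x \<and> (\<forall>i\<in>D j. y i = x i)" if "j \<in> {1..c}" for j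
  proof -
    have "\<not> own C x (D j)"
    proof (cases "j \<le> l")
      case False
      then have "j - l - 1 < c - l" using that par by auto
      then show ?thesis using no B(1) False by (auto simp: D_def)
    qed (use A that in \<open>auto simp: D_def\<close>)
    then show ?thesis by (auto simp: own_def)
  qed
  then obtain y where y: "\<And>j. j \<in> {1..c} \<Longrightarrow> y j \<in> C \<and> y j \<noteq> x \<and> (\<forall>i\<in>D j. y j i = x i)"
    by metis
  define z where "z j = (if j = 0 then x else y j)" for j
  have "\<forall>j\<in>{0..c}. z j \<in> C" "\<forall>j\<in>{1..c}. z 0 \<noteq> z j" using y C(2) by (force simp: z_def)+
  then obtain i where i: "i \<in> {1..n}" "card {j\<in>{1..c}. z j i = z 0 i} < s"
    using C(1) unfolding frameproof_def by blast
  have "{j\<in>{1..l}. i \<in> A j} \<union> (\<lambda>j. j + l + 1) ` {j. j < c - l \<and> i \<in> B j} \<subseteq> {j\<in>{1..c}. z j i = z 0 i}"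
  proof -
    have "j \<in> {j\<in>{1..c}. z j i = z 0 i}" if "j \<in> {1..c}" "i \<in> D j" for j
      using y[of j] that by (auto simp: z_def)
    moreover have "j \<in> {1..c} \<and> i \<in> D j" if "j \<in> {1..l}" "i \<in> A j" for j
      using that par by (auto simp: D_def)
    moreover have "j + l + 1 \<in> {1..c} \<and> i \<in> D (j + l + 1)" if "j < c - l" "i \<in> B j" for j
      using that by (auto simp: D_def)
    ultimately show ?thesis by blast
  qed
  then have "card ({j\<in>{1..l}. i \<in> A j} \<union> (\<lambda>j. j + l + 1) ` {j. j < c - l \<and> i \<in> B j})
      \<le> card {j\<in>{1..c}. z j i = z 0 i}" by (intro card_mono) auto
  also have "card ({j\<in>{1..l}. i \<in> A j} \<union> (\<lambda>j. j + l + 1) ` {j. j < c - l \<and> i \<in> B j}) =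
      deg i + (s - deg i)"
    using B(2) i(1) by (subst card_Un_disjoint) (auto simp: deg_def card_image inj_on_def)
  finally show False using deg_le[of i] i by simp
qed

text \<open>Double counting of pairs of a word of \<open>C2\<close> and one of its own t-sets.
  Ownership refers to all of \<open>C\<close>, not to \<open>C2\<close>, so that the matching
  argument and the bound of q^t words per t-set both apply directly.\<close>

lemma card_frameproof_le:
  assumes C: "C \<subseteq> words q n" "frameproof c s n C"
    and par: "s * n = c * (t - 1) + l" "1 \<le> s" "s \<le> c" "l \<in> {1..c}" "t \<ge> 1"
  defines "d \<equiv> (n choose t) - gen_matching_number n t l (s + 1) (c - s + 1)"
  shows "card C * d \<le> (n choose t) * q ^ t + d * ((n choose (t - 1)) * q ^ (t - 1))"
proof -
  have fC: "finite C" using C(1) finite_words finite_subset by blast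
  define C1 where "C1 = {x\<in>C. \<exists>S\<in>ksets n (t - 1). own C x S}"
  define C2 where "C2 = C - C1"
  have C1: "card C1 \<le> (n choose (t - 1)) * q ^ (t - 1)"
  proof -
    have "C1 = (\<Union>S\<in>ksets n (t - 1). {x\<in>C. own C x S})" unfolding C1_def by blast
    then have "card C1 \<le> (\<Sum>S\<in>ksets n (t - 1). card {x\<in>C. own C x S})"
      by (simp only: card_UN_le[OF finite_ksets])
    also have "\<dots> \<le> (\<Sum>S\<in>ksets n (t - 1). q ^ (t - 1))"
    proof (rule sum_mono)
      fix S assume "S \<in> ksets n (t - 1)"
      then have "S \<subseteq> {1..n}" "card S = t - 1" by blast+
      then show "card {x\<in>C. own C x S} \<le> q ^ (t - 1)" using card_own_le[OF C(1), of S] by simp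
    qed
    also have "\<dots> = (n choose (t - 1)) * q ^ (t - 1)" by (simp only: sum_constant card_ksets of_nat_id)
    finally show ?thesis .
  qed
  have "card C2 * d = (\<Sum>x\<in>C2. d)" by simp
  also have "\<dots> \<le> (\<Sum>x\<in>C2. card {T\<in>ksets n t. own C x T})"
  proof (rule sum_mono)
    fix x assume x: "x \<in> C2"
    have "matching_free n l (s + 1) (c - s + 1) {T \<in> ksets n t. \<not> own C x T}"
    proof (rule matching_free_not_own[OF C(2) _ _ par])
      show "x \<in> C" using x by (simp add: C2_def)
      show "\<not> own C x S" if "S \<in> ksets n (t - 1)" for S
        using x that unfolding C1_def C2_def by blast
    qed
    then have m: "card {T \<in> ksets n t. \<not> own C x T} \<le> gen_matching_number n t l (s + 1) (c - s + 1)"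
      by (rule gen_matching_number_ge[rotated]) blast
    have "finite {T \<in> ksets n t. \<not> own C x T}"
      by (rule finite_subset[OF _ finite_ksets[of n t]]) blast
    then have "card (ksets n t - {T \<in> ksets n t. \<not> own C x T})
        = card (ksets n t) - card {T \<in> ksets n t. \<not> own C x T}"
      by (rule card_Diff_subset) blast
    moreover have "ksets n t - {T \<in> ksets n t. \<not> own C x T} = {T\<in>ksets n t. own C x T}" by blast
    ultimately have "card {T\<in>ksets n t. own C x T} = (n choose t) - card {T \<in> ksets n t. \<not> own C x T}"
      by (simp only: card_ksets)
    then show "d \<le> card {T\<in>ksets n t. own C x T}"
      unfolding d_def by (simp only: diff_le_mono2[OF m])
  qed
  also have "\<dots> = (\<Sum>T\<in>ksets n t. card {x\<in>C2. own C x T})"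
  proof -
    have "finite C2" using fC by (simp add: C2_def)
    then have "(\<Sum>x\<in>C2. card {T\<in>ksets n t. own C x T})
        = (\<Sum>T\<in>ksets n t. card {x\<in>C2. T \<in> {T\<in>ksets n t. own C x T}})"
      by (intro sum_card_eq_sum_degree finite_ksets) blast+
    also have "\<dots> = (\<Sum>T\<in>ksets n t. card {x\<in>C2. own C x T})"
      by (intro sum.cong arg_cong[where f = card] refl) blast
    finally show ?thesis .
  qed
  also have "\<dots> \<le> (\<Sum>T\<in>ksets n t. q ^ t)"
  proof (rule sum_mono)
    fix T assume T: "T \<in> ksets n t"
    have "card {x\<in>C2. own C x T} \<le> card {x\<in>C. own C x T}"
      using fC by (intro card_mono) (auto simp: C2_def)
    also have "\<dots> \<le> q ^ t" using card_own_le[OF C(1), of T] T by blast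
    finally show "card {x\<in>C2. own C x T} \<le> q ^ t" .
  qed
  also have "\<dots> = (n choose t) * q ^ t" by (simp only: sum_constant card_ksets of_nat_id)
  finally have "card C2 * d \<le> (n choose t) * q ^ t" .
  moreover have "card C = card C1 + card C2"
  proof -
    have "C1 \<subseteq> C" by (auto simp: C1_def)
    then have "card C2 = card C - card C1" "card C1 \<le> card C"
      unfolding C2_def using fC by (auto intro: card_Diff_subset card_mono finite_subset)
    then show ?thesis by linarith
  qed
  moreover have "card C1 * d \<le> d * ((n choose (t - 1)) * q ^ (t - 1))"
    using mult_le_mono1[OF C1, of d] by (simp only: mult.commute)
  ultimately show ?thesis by (simp only: add_mult_distrib)
qed

section \<open>Frameproofness from restricted agreement sets\<close>

text \<open>A violation of frameproofness can be shrunk to agreement sets covering each coordinate exactly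
  s times; these have size at most t and total size c(t-1)+l, so at least l of them have size t.\<close>

lemma frameproof_of_small_agreement:
  assumes F: "\<And>x. x \<in> C \<Longrightarrow> \<exists>F. matching_free n l (s + 1) (c - s + 1) F \<and>
      (\<forall>y\<in>C. y \<noteq> x \<longrightarrow> card {i\<in>{1..n}. y i = x i} \<le> t \<and>
        (card {i\<in>{1..n}. y i = x i} = t \<longrightarrow> {i\<in>{1..n}. y i = x i} \<in> F))"
    and par: "s * n = c * (t - 1) + l" "1 \<le> s" "s \<le> c" "l \<in> {1..c}" "t \<ge> 1"
  shows "frameproof c s n C"
  unfolding frameproof_def
proof (intro allI impI; elim conjE)
  fix x :: "nat \<Rightarrow> nat \<Rightarrow> nat"
  assume x: "\<forall>j\<in>{0..c}. x j \<in> C" "\<forall>j\<in>{1..c}. x 0 \<noteq> x j"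
  show "\<exists>i\<in>{1..n}. card {j\<in>{1..c}. x j i = x 0 i} < s"
  proof (rule ccontr)
    assume "\<not> ?thesis"
    then have "\<forall>i\<in>{1..n}. \<exists>B. B \<subseteq> {j\<in>{1..c}. x j i = x 0 i} \<and> card B = s"
      by (meson obtain_subset_with_card_n not_le)
    then obtain B where B: "\<And>i. i \<in> {1..n} \<Longrightarrow> B i \<subseteq> {j\<in>{1..c}. x j i = x 0 i} \<and> card (B i) = s"
      by metis
    obtain F where F': "matching_free n l (s + 1) (c - s + 1) F"
      "\<And>y. y \<in> C \<Longrightarrow> y \<noteq> x 0 \<Longrightarrow> card {i\<in>{1..n}. y i = x 0 i} \<le> t \<and>
        (card {i\<in>{1..n}. y i = x 0 i} = t \<longrightarrow> {i\<in>{1..n}. y i = x 0 i} \<in> F)"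
      using F[of "x 0"] x(1) by auto
    define A where "A j = {i\<in>{1..n}. j \<in> B i}" for j
    have sub: "A j \<subseteq> {i\<in>{1..n}. x j i = x 0 i}" for j using B by (auto simp: A_def)
    have le: "card (A j) \<le> t" and inF: "card (A j) = t \<Longrightarrow> A j \<in> F" if "j \<in> {1..c}" for j
    proof -
      have 1: "card (A j) \<le> card {i\<in>{1..n}. x j i = x 0 i}" by (intro card_mono sub) auto
      have 2: "card {i\<in>{1..n}. x j i = x 0 i} \<le> t \<and>
        (card {i\<in>{1..n}. x j i = x 0 i} = t \<longrightarrow> {i\<in>{1..n}. x j i = x 0 i} \<in> F)"
        using that x by (intro F'(2)) fastforce+
      show "card (A j) \<le> t" using 1 2 by simp
      \<comment> \<open>Membership in \<open>F\<close> survives the shrinking: the agreement set has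
        at most t points, so a shrunken set with t points is all of it.\<close>
      assume t: "card (A j) = t"
      then have "A j = {i\<in>{1..n}. x j i = x 0 i}" using 1 2 by (intro card_subset_eq sub) auto
      then show "A j \<in> F" using 2 t by simp
    qed
    have deg: "card {j\<in>{1..c}. i \<in> A j} = s" if "i \<in> {1..n}" for i
    proof -
      have "{j\<in>{1..c}. i \<in> A j} = B i" using B that by (auto simp: A_def)
      then show ?thesis using B that by simp
    qed
    define J where "J = {j\<in>{1..c}. card (A j) = t}"
    have "c * (t - 1) + l = (\<Sum>i\<in>{1..n}. card {j\<in>{1..c}. i \<in> A j})"
      using deg par by (simp add: mult.commute)
    also have "\<dots> = (\<Sum>j\<in>{1..c}. card (A j))"
      by (rule sum_card_eq_sum_degree[symmetric]) (auto simp: A_def)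
    also have "\<dots> \<le> (\<Sum>j\<in>{1..c}. (t - 1) + (if j \<in> J then 1 else 0))"
      using le by (intro sum_mono) (force simp: J_def)
    also have "\<dots> = c * (t - 1) + card J"
    proof -
      have "{1..c} \<inter> J = J" by (auto simp: J_def)
      then show ?thesis by (simp only: sum.distrib) (simp add: sum.If_cases)
    qed
    finally have "card {1..l} \<le> card J" by simp
    then obtain \<tau> where \<tau>: "\<tau> ` {1..l} \<subseteq> J" "inj_on \<tau> {1..l}"
      using card_le_inj[of "{1..l}" J] by (auto simp: J_def)
    have "disjoint_covering_seq n l (s + 1) (c - s + 1) (A \<circ> \<tau>)"
    proof (rule disjoint_covering_seq_of_exact_cover)
      show "\<tau> ` {1..l} \<subseteq> {1..c}" using \<tau>(1) by (auto simp: J_def)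
    qed (use deg par \<tau> in \<open>auto simp: A_def\<close>)
    moreover have "\<forall>i\<in>{1..l}. (A \<circ> \<tau>) i \<in> F" using \<tau>(1) inF by (auto simp: J_def)
    ultimately show False using F'(1) unfolding matching_free_def by blast
  qed
qed

text \<open>Lets each word use its own relabelled copy of one extremal family. The bound on
  \<open>k1\<close> keeps the index set B nonempty, where images under an injection commute with
  intersections.\<close>

lemma matching_free_permute:
  assumes F: "matching_free n l k1 k2 F" and \<pi>: "\<pi> permutes {1..n}" and "k1 \<ge> 1"
  shows "matching_free n l k1 k2 ((`) \<pi> ` F)"
  unfolding matching_free_def
proof
  assume "\<exists>A. (\<forall>i\<in>{1..l}. A i \<in> (`) \<pi> ` F) \<and> disjoint_covering_seq n l k1 k2 A"
  then obtain A where A: "\<forall>i\<in>{1..l}. A i \<in> (`) \<pi> ` F" "disjoint_covering_seq n l k1 k2 A" by blast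
  then have "\<forall>i\<in>{1..l}. \<exists>A'. A' \<in> F \<and> A i = \<pi> ` A'" by blast
  then obtain A' where A': "\<And>i. i \<in> {1..l} \<Longrightarrow> A' i \<in> F \<and> A i = \<pi> ` A' i" by metis
  have inj: "inj \<pi>" using \<pi> permutes_inj by blast
  have "disjoint_covering_seq n l k1 k2 A'"
    unfolding disjoint_covering_seq_def disjoint_seq_def covering_seq_def
  proof (intro conjI allI impI; elim conjE)
    fix B assume B: "B \<subseteq> {1..l}" "card B = k1"
    then have "B \<noteq> {}" using assms(3) by auto
    have "\<pi> ` (\<Inter>i\<in>B. A' i) = (\<Inter>i\<in>B. \<pi> ` A' i)"
      using inj \<open>B \<noteq> {}\<close> by (metis image_INT inj_on_subset subset_UNIV ex_in_conv)
    also have "\<dots> = (\<Inter>i\<in>B. A i)" using A' B by (intro INF_cong) auto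
    also have "\<dots> = {}" using A(2) B by (auto simp: disjoint_covering_seq_def disjoint_seq_def)
    finally show "(\<Inter>i\<in>B. A' i) = {}" by simp
  next
    fix B assume B: "B \<subseteq> {1..l}" "card B = k2"
    have "\<pi> ` (\<Union>i\<in>B. A' i) = (\<Union>i\<in>B. A i)" unfolding image_UN using A' B(1) by (intro SUP_cong) auto
    also have "\<dots> = \<pi> ` {1..n}"
      using A(2) B permutes_image[OF \<pi>] by (auto simp: disjoint_covering_seq_def covering_seq_def)
    finally show "(\<Union>i\<in>B. A' i) = {1..n}" using inj by (simp add: inj_image_eq_iff)
  qed
  then show False using F A' unfolding matching_free_def by blast
qed

section \<open>Linear hashing modulo a prime\<close>

text \<open>A functional good for the old vectors is moved along one coordinate \<open>i0\<close> at
  which the new vector is nonzero. Every vector excludes at most one shift mod p, so fewer than p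
  vectors leave a shift free.\<close>

lemma separating_functional:
  fixes p :: int and w :: "'j \<Rightarrow> 'i \<Rightarrow> int"
  assumes p: "prime p" and I: "finite I" and J: "finite J" "int (card J) < p"
    and w: "\<And>j. j \<in> J \<Longrightarrow> \<exists>i\<in>I. \<not> p dvd w j i"
  shows "\<exists>\<phi>. \<forall>j\<in>J. \<not> p dvd (\<Sum>i\<in>I. \<phi> i * w j i)"
  using J w
proof (induction J rule: finite_induct)
  case empty
  then show ?case by simp
next
  case (insert j J)
  obtain \<phi> where \<phi>: "\<And>m. m \<in> J \<Longrightarrow> \<not> p dvd (\<Sum>i\<in>I. \<phi> i * w m i)"
    using insert.IH insert.prems insert.hyps by force
  obtain i0 where i0: "i0 \<in> I" "\<not> p dvd w j i0" using insert.prems(2) by blast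
  define bad where "bad m = {\<tau> \<in> {0..<p}. p dvd (\<Sum>i\<in>I. \<phi> i * w m i) + \<tau> * w m i0}" for m
  have fin: "finite (bad m)" for m
    by (rule finite_subset[of _ "{0..<p}"]) (auto simp: bad_def)
  have bad1: "card (bad m) \<le> 1" if m: "m \<in> insert j J" for m
  proof -
    have "\<tau> = \<tau>'" if "\<tau> \<in> bad m" "\<tau>' \<in> bad m" for \<tau> \<tau>'
    proof -
      have d: "p dvd (\<Sum>i\<in>I. \<phi> i * w m i) + \<tau> * w m i0" "p dvd (\<Sum>i\<in>I. \<phi> i * w m i) + \<tau>' * w m i0"
        and r: "\<tau> \<in> {0..<p}" "\<tau>' \<in> {0..<p}"
        using that unfolding bad_def by blast+
      \<comment> \<open>An old vector vanishing at \<open>i0\<close> is not affected by the shift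
        and has no bad shift at all; hence a vector with a bad shift is nonzero there.\<close>
      have nd: "\<not> p dvd w m i0"
      proof
        assume "p dvd w m i0"
        then have "p dvd (\<Sum>i\<in>I. \<phi> i * w m i)" using d(1) by (simp add: dvd_add_left_iff)
        then show False using \<phi>[of m] m i0(2) \<open>p dvd w m i0\<close> by blast
      qed
      have "p dvd ((\<Sum>i\<in>I. \<phi> i * w m i) + \<tau> * w m i0) - ((\<Sum>i\<in>I. \<phi> i * w m i) + \<tau>' * w m i0)"
        by (rule dvd_diff[OF d])
      then have "p dvd (\<tau> - \<tau>') * w m i0" by (simp add: algebra_simps)
      then have "p dvd \<tau> - \<tau>'" using nd p prime_dvd_mult_iff by blast
      then show "\<tau> = \<tau>'" using r
        by (metis atLeastLessThan_iff mod_eq_dvd_iff mod_pos_pos_trivial)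
    qed
    moreover have "finite (bad m)" by (rule fin)
    ultimately show ?thesis by (metis card_le_Suc0_iff_eq One_nat_def)
  qed
  have "card (\<Union>m\<in>insert j J. bad m) \<le> (\<Sum>m\<in>insert j J. card (bad m))"
    using insert.hyps by (intro card_UN_le) simp
  also have "\<dots> \<le> (\<Sum>m\<in>insert j J. 1)" using bad1 by (rule sum_mono)
  also have "\<dots> = card (insert j J)" by simp
  finally have "card (\<Union>m\<in>insert j J. bad m) \<le> card (insert j J)" .
  then have "card (\<Union>m\<in>insert j J. bad m) < card {0..<p}" using insert.prems(1) by simp
  moreover have "finite (\<Union>m\<in>insert j J. bad m)" using insert.hyps fin by blast
  ultimately have "\<not> {0..<p} \<subseteq> (\<Union>m\<in>insert j J. bad m)"
    using card_mono by (meson not_less)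
  then obtain \<tau> where \<tau>: "\<tau> \<in> {0..<p}" "\<And>m. m \<in> insert j J \<Longrightarrow> \<tau> \<notin> bad m" by blast
  define \<phi>' where "\<phi>' i = \<phi> i + (if i = i0 then \<tau> else 0)" for i
  have "(\<Sum>i\<in>I. \<phi>' i * w m i) = (\<Sum>i\<in>I. \<phi> i * w m i) + \<tau> * w m i0" for m
  proof -
    have "(\<Sum>i\<in>I. \<phi>' i * w m i) = (\<Sum>i\<in>I. \<phi> i * w m i + (if i = i0 then \<tau> * w m i else 0))"
      by (intro sum.cong) (auto simp: \<phi>'_def algebra_simps)
    then show ?thesis using I i0(1) by (simp add: sum.distrib)
  qed
  then have "\<forall>m\<in>insert j J. \<not> p dvd (\<Sum>i\<in>I. \<phi>' i * w m i)"
    using \<tau> unfolding bad_def by auto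
  then show ?case by blast
qed

text \<open>Subspaces of the functions from I to Z/p are represented by sets of integer-valued functions;
  their size is the number of residue vectors on I.\<close>

definition residues_on :: "int \<Rightarrow> 'i set \<Rightarrow> ('i \<Rightarrow> int) \<Rightarrow> 'i \<Rightarrow> int" where
  "residues_on p I w = (\<lambda>i\<in>I. w i mod p)"

lemma residues_on_in: "p > 0 \<Longrightarrow> residues_on p I w \<in> I \<rightarrow>\<^sub>E {0..<p}"
  by (auto simp: residues_on_def)

lemma finite_residues_on:
  assumes "finite I" "p > 0" shows "finite (residues_on p I ` K)"
proof (rule finite_subset)
  show "residues_on p I ` K \<subseteq> I \<rightarrow>\<^sub>E {0..<p}" 
    by (rule image_subsetI) (rule residues_on_in[OF assms(2)])
  show "finite (I \<rightarrow>\<^sub>E {0..<p})" using assms(1) by (simp add: finite_PiE)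
qed

lemma residues_on_eq_iff:
  "residues_on p I u = residues_on p I v \<longleftrightarrow> (\<forall>i\<in>I. p dvd u i - v i)"
proof
  assume "residues_on p I u = residues_on p I v"
  then have "\<forall>i\<in>I. u i mod p = v i mod p" unfolding residues_on_def by (metis restrict_apply')
  then show "\<forall>i\<in>I. p dvd u i - v i" by (simp add: mod_eq_dvd_iff)
next
  assume "\<forall>i\<in>I. p dvd u i - v i"
  then show "residues_on p I u = residues_on p I v"
    unfolding residues_on_def by (intro restrict_ext) (simp add: mod_eq_dvd_iff)
qed

text \<open>Induction on the exponent: a functional that is nonzero somewhere on each nontrivial
  space cuts all these spaces by a factor p. Having fewer than p spaces lets one functional serve
  all of them. Closure under \<open>u + a * v\<close> is the subspace property in terms of
  representatives.\<close>

lemma common_injective_functionals: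
  fixes p :: int and K :: "'j \<Rightarrow> ('i \<Rightarrow> int) set"
  assumes p: "prime p" and I: "finite I" and J: "finite J" "int (card J) < p"
    and grp: "\<And>j u v a. j \<in> J \<Longrightarrow> u \<in> K j \<Longrightarrow> v \<in> K j \<Longrightarrow> (\<lambda>i. u i + a * v i) \<in> K j"
    and card: "\<And>j. j \<in> J \<Longrightarrow> card (residues_on p I ` K j) \<le> nat p ^ e"
  shows "\<exists>\<phi>::nat \<Rightarrow> 'i \<Rightarrow> int. \<forall>j\<in>J. \<forall>w\<in>K j.
           (\<forall>l<e. p dvd (\<Sum>i\<in>I. \<phi> l i * w i)) \<longrightarrow> (\<forall>i\<in>I. p dvd w i)"
  using grp card
proof (induction e arbitrary: K)
  case 0
  have "p > 0" using p prime_gt_0_int by blast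
  have "\<forall>i\<in>I. p dvd w i" if j: "j \<in> J" and w: "w \<in> K j" for j w
  proof -
    have "(\<lambda>i. w i + (- 1) * w i) \<in> K j" using j w w by (rule 0(1))
    then have "(\<lambda>i. 0) \<in> K j" by simp
    moreover have "card (residues_on p I ` K j) \<le> Suc 0" using 0(2)[OF j] by simp
    moreover have "finite (residues_on p I ` K j)" by (rule finite_residues_on[OF I \<open>p > 0\<close>])
    ultimately have "residues_on p I w = residues_on p I (\<lambda>i. 0)"
      using w by (metis card_le_Suc0_iff_eq imageI)
    then show ?thesis by (simp add: residues_on_eq_iff)
  qed
  then show ?case by blast
next
  case (Suc e)
  have p0: "p > 0" using p prime_gt_0_int by blast
  \<comment> \<open>Spaces that vanish mod p offer no vector to test, but they consist of a single
    residue vector and satisfy the bound for every exponent.\<close>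
  define J' where "J' = {j\<in>J. \<exists>w\<in>K j. \<exists>i\<in>I. \<not> p dvd w i}"
  have "\<forall>j\<in>J'. \<exists>w. w \<in> K j \<and> (\<exists>i\<in>I. \<not> p dvd w i)" unfolding J'_def by blast
  then obtain w where w: "\<And>j. j \<in> J' \<Longrightarrow> w j \<in> K j \<and> (\<exists>i\<in>I. \<not> p dvd w j i)" by metis
  have J'J: "J' \<subseteq> J" by (auto simp: J'_def)
  then have "finite J'" "card J' \<le> card J" using J(1) finite_subset card_mono by auto
  then obtain \<phi>0 where \<phi>0: "\<And>j. j \<in> J' \<Longrightarrow> \<not> p dvd (\<Sum>i\<in>I. \<phi>0 i * w j i)"
    using separating_functional[OF p I, of J' w] w J(2) by auto
  define K' where "K' j = {u \<in> K j. p dvd (\<Sum>i\<in>I. \<phi>0 i * u i)}" for j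
  have grp': "(\<lambda>i. u i + a * v i) \<in> K' j" if "j \<in> J" "u \<in> K' j" "v \<in> K' j" for j u v a
  proof -
    have "(\<Sum>i\<in>I. \<phi>0 i * (u i + a * v i)) = (\<Sum>i\<in>I. \<phi>0 i * u i) + a * (\<Sum>i\<in>I. \<phi>0 i * v i)"
      by (simp add: algebra_simps sum.distrib sum_distrib_left)
    then show ?thesis using that Suc.prems(1)[of j u v a] by (simp add: K'_def)
  qed
  have card': "card (residues_on p I ` K' j) \<le> nat p ^ e" if j: "j \<in> J" for j
  proof (cases "j \<in> J'")
    case False
    have "residues_on p I ` K' j \<subseteq> {residues_on p I (\<lambda>i. 0)}"
    proof (rule image_subsetI)
      fix u assume "u \<in> K' j"
      then have "\<forall>i\<in>I. p dvd u i" using False j by (auto simp: K'_def J'_def)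
      then show "residues_on p I u \<in> {residues_on p I (\<lambda>i. 0)}" by (simp add: residues_on_eq_iff)
    qed
    then have "card (residues_on p I ` K' j) \<le> card {residues_on p I (\<lambda>i. 0)}"
      by (intro card_mono) auto
    also have "\<dots> \<le> nat p ^ e" using p0 by simp
    finally show ?thesis .
  next
    case True
    let ?f = "\<lambda>(u, \<tau>). residues_on p I (\<lambda>i. u i + \<tau> * w j i)"
    \<comment> \<open>The kernel \<open>K' j\<close> and the multiples of \<open>w j\<close> meet
      only in 0, so their sum embeds into the space \<open>K j\<close>; this is the gain of a factor
      p. The map acts on residues, which is why representatives are compared mod p below.\<close>
    have "card (residues_on p I ` K' j \<times> {0..<p}) \<le> card (residues_on p I ` K j)"
    proof (rule card_inj_on_le)
      show "finite (residues_on p I ` K j)" by (rule finite_residues_on[OF I p0])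
      show "?f ` (residues_on p I ` K' j \<times> {0..<p}) \<subseteq> residues_on p I ` K j"
      proof (clarsimp simp: image_iff)
        fix u \<tau> assume u: "u \<in> K' j"
        have "residues_on p I (\<lambda>i. residues_on p I u i + \<tau> * w j i) = residues_on p I (\<lambda>i. u i + \<tau> * w j i)"
          unfolding residues_on_eq_iff
        proof
          fix i assume "i \<in> I"
          then have "residues_on p I u i + \<tau> * w j i - (u i + \<tau> * w j i) = u i mod p - u i"
            by (simp add: residues_on_def)
          then show "p dvd residues_on p I u i + \<tau> * w j i - (u i + \<tau> * w j i)"
            using dvd_minus_mod[of p "u i"] by (simp add: dvd_diff_commute)
        qed
        moreover have "(\<lambda>i. u i + \<tau> * w j i) \<in> K j"
          using u w[OF True] j by (intro Suc.prems(1)) (auto simp: K'_def)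
        ultimately show "\<exists>x\<in>K j. residues_on p I (\<lambda>i. residues_on p I u i + \<tau> * w j i) = residues_on p I x"
          by blast
      qed
      show "inj_on ?f (residues_on p I ` K' j \<times> {0..<p})"
      proof (rule inj_onI, clarify)
        fix u v \<tau> \<sigma>
        assume u: "u \<in> K' j" and v: "v \<in> K' j" and r: "\<tau> \<in> {0..<p}" "\<sigma> \<in> {0..<p}"
          and eq: "residues_on p I (\<lambda>i. residues_on p I u i + \<tau> * w j i) =
             residues_on p I (\<lambda>i. residues_on p I v i + \<sigma> * w j i)"
        have 1: "p dvd u i + \<tau> * w j i - (v i + \<sigma> * w j i)" if "i \<in> I" for i
        proof -
          have "p dvd u i mod p + \<tau> * w j i - (v i mod p + \<sigma> * w j i)"
            using eq[unfolded residues_on_eq_iff, rule_format, OF that] that by (simp add: residues_on_def)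
          then have "p dvd (u i mod p + \<tau> * w j i - (v i mod p + \<sigma> * w j i)) +
             (u i - u i mod p) - (v i - v i mod p)"
            using dvd_diff[OF dvd_add[OF _ dvd_minus_mod] dvd_minus_mod] by blast
          then show ?thesis by (simp add: algebra_simps)
        qed
        then have "p dvd (\<Sum>i\<in>I. \<phi>0 i * (u i + \<tau> * w j i - (v i + \<sigma> * w j i)))"
          by (intro dvd_sum dvd_mult)
        also have "(\<Sum>i\<in>I. \<phi>0 i * (u i + \<tau> * w j i - (v i + \<sigma> * w j i))) =
           (\<Sum>i\<in>I. \<phi>0 i * u i) - (\<Sum>i\<in>I. \<phi>0 i * v i) + (\<tau> - \<sigma>) * (\<Sum>i\<in>I. \<phi>0 i * w j i)"
          by (simp add: algebra_simps sum.distrib sum_distrib_left sum_subtractf)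
        finally have "p dvd (\<tau> - \<sigma>) * (\<Sum>i\<in>I. \<phi>0 i * w j i)"
          using u v by (auto simp: K'_def dvd_add_right_iff)
        then have "p dvd \<tau> - \<sigma>" using \<phi>0[OF True] p prime_dvd_mult_iff by blast
        then have "\<tau> = \<sigma>" using r by (metis atLeastLessThan_iff mod_eq_dvd_iff mod_pos_pos_trivial)
        moreover have "residues_on p I u = residues_on p I v"
          unfolding residues_on_eq_iff using 1 \<open>\<tau> = \<sigma>\<close> by simp
        ultimately show "residues_on p I u = residues_on p I v \<and> \<tau> = \<sigma>" by simp
      qed
    qed
    then have "card (residues_on p I ` K' j) * nat p \<le> card (residues_on p I ` K j)"
      by (simp add: card_cartesian_product)
    also have "\<dots> \<le> nat p ^ e * nat p" using Suc.prems(2)[OF j] by (simp add: mult.commute)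
    finally show ?thesis by (rule mult_right_le_imp_le) (use p0 in simp)
  qed
  obtain \<phi> where \<phi>: "\<And>j u. j \<in> J \<Longrightarrow> u \<in> K' j \<Longrightarrow>
      (\<forall>l<e. p dvd (\<Sum>i\<in>I. \<phi> l i * u i)) \<Longrightarrow> (\<forall>i\<in>I. p dvd u i)"
    using Suc.IH[of K', OF grp' card'] by blast
  have "\<forall>i\<in>I. p dvd u i" if j: "j \<in> J" and u: "u \<in> K j"
    and d: "\<forall>l<Suc e. p dvd (\<Sum>i\<in>I. (case l of 0 \<Rightarrow> \<phi>0 | Suc l \<Rightarrow> \<phi> l) i * u i)" for j u
  proof (rule \<phi>[OF j])
    show "u \<in> K' j" using u d[rule_format, of 0] by (simp add: K'_def)
    show "\<forall>l<e. p dvd (\<Sum>i\<in>I. \<phi> l i * u i)" using d[rule_format, of "Suc _"] by simp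
  qed
  then show ?case by (intro exI[of _ "\<lambda>l. case l of 0 \<Rightarrow> \<phi>0 | Suc l \<Rightarrow> \<phi> l"]) blast
qed

text \<open>Stands in for a dimension count: the size of a space is bounded through a set of
  coordinates that determines its vectors.\<close>

lemma card_residues_on_le:
  assumes "finite I'" "I' \<subseteq> I" "p > 0"
    and "\<And>u v. u \<in> K \<Longrightarrow> v \<in> K \<Longrightarrow> \<forall>i\<in>I'. p dvd u i - v i \<Longrightarrow> \<forall>i\<in>I. p dvd u i - v i"
  shows "card (residues_on p I ` K) \<le> nat p ^ card I'"
proof -
  have "card (residues_on p I ` K) \<le> card (I' \<rightarrow>\<^sub>E {0..<p})"
  proof (rule card_inj_on_le)
    show "finite (I' \<rightarrow>\<^sub>E {0..<p})" using assms(1) by (simp add: finite_PiE)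
    show "(\<lambda>x. restrict x I') ` residues_on p I ` K \<subseteq> I' \<rightarrow>\<^sub>E {0..<p}"
      using assms(2,3) by (auto simp: residues_on_def)
    show "inj_on (\<lambda>x. restrict x I') (residues_on p I ` K)"
    proof (rule inj_onI, clarify)
      fix u v assume uv: "u \<in> K" "v \<in> K"
        and eq: "restrict (residues_on p I u) I' = restrict (residues_on p I v) I'"
      have "p dvd u i - v i" if i: "i \<in> I'" for i
      proof -
        have "residues_on p I u i = residues_on p I v i" using eq i by (metis restrict_apply')
        then show ?thesis using i assms(2) by (auto simp: residues_on_def mod_eq_dvd_iff)
      qed
      then show "residues_on p I u = residues_on p I v"
        using assms(4)[OF uv] by (simp add: residues_on_eq_iff)
    qed
  qed
  then show ?thesis using assms(1) by (simp add: card_PiE)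
qed

lemma exists_large_fibre:
  assumes "finite A" "finite B" "B \<noteq> {}" "f ` A \<subseteq> B"
  shows "\<exists>b\<in>B. card A \<le> card B * card {x\<in>A. f x = b}"
proof (rule ccontr)
  assume "\<not> ?thesis"
  then have less: "\<And>b. b \<in> B \<Longrightarrow> card B * card {x\<in>A. f x = b} < card A" by (auto simp: not_le)
  have "card (\<Union>b\<in>B. {x\<in>A. f x = b}) = (\<Sum>b\<in>B. card {x\<in>A. f x = b})"
    using assms(1,2) by (intro card_UN_disjoint) auto
  moreover have "(\<Union>b\<in>B. {x\<in>A. f x = b}) = A" using assms(4) by blast
  ultimately have "card A = (\<Sum>b\<in>B. card {x\<in>A. f x = b})" by simp
  then have "card B * card A = (\<Sum>b\<in>B. card B * card {x\<in>A. f x = b})"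
    by (simp add: sum_distrib_left)
  also have "\<dots> < (\<Sum>b\<in>B. card A)" using less assms by (intro sum_strict_mono) auto
  finally show False by simp
qed

section \<open>Labelled words\<close>

lemma eq_of_dvd_diff:
  fixes a b p :: int
  assumes "p dvd a - b" "a \<in> {0..<p}" "b \<in> {0..<p}"
  shows "a = b"
  using assms by (metis atLeastLessThan_iff mod_eq_dvd_iff mod_pos_pos_trivial)

locale labelled_words =
  fixes n t p :: nat
  assumes t: "1 \<le> t" "t \<le> n" and p: "prime p"
begin

definition TT where "TT = ksets n t"
definition k where "k = n choose t"
text \<open>The dimension of the space of differences of words with equal symbols on a t-set S and
  equal labels: k * (n - t) free entries, less one for each label other than that at S. The 1 is
  added first because k * (n - t) is 0 for t = n, where k = 1.\<close>

definition e where "e = k * (n - t) + 1 - k"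
definition I where "I = {1..n} \<times> TT"
definition X where "X = I \<rightarrow>\<^sub>E {0..<int p}"
text \<open>Only coordinates in \<open>T\<close> enter, so agreement on \<open>T\<close> forces
  equal labels there. The entries with index \<open>T\<close> occur in no other label, so all labels
  can be prescribed independently.\<close>

definition lab :: "nat set \<Rightarrow> (nat \<times> nat set \<Rightarrow> int) \<Rightarrow> int" where
  "lab T x = (\<Sum>i\<in>T. x (i, T))"
definition agree :: "(nat \<times> nat set \<Rightarrow> int) \<Rightarrow> (nat \<times> nat set \<Rightarrow> int) \<Rightarrow> nat set \<Rightarrow> bool" where
  "agree x y S \<longleftrightarrow> (\<forall>i\<in>S. \<forall>T\<in>TT. x (i, T) = y (i, T))"

lemma TT_D:
  assumes "T \<in> TT" shows "T \<subseteq> {1..n}" "card T = t" "finite T"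
  using assms finite_subset[of T "{1..n}"] unfolding TT_def by blast+

lemma finite_TT: "finite TT" and card_TT: "card TT = k"
  unfolding TT_def k_def by (rule finite_ksets, rule card_ksets)

lemma k_pos: "k \<ge> 1"
  using t by (simp add: k_def Suc_le_eq)

lemma finite_I: "finite I" and card_I: "card I = k * n"
  using finite_TT card_TT by (simp_all add: I_def card_cartesian_product mult.commute)

lemma finite_X: "finite X"
  using finite_I by (simp add: X_def finite_PiE)

lemma p_pos: "p > 0" "prime (int p)"
  using p prime_gt_0_nat by auto

lemma exponent_eq: "k * n - k + 1 = k * t + e"
proof -
  have kn: "k * n = k * t + k * (n - t)" using t by (metis add_mult_distrib2 le_add_diff_inverse)
  show ?thesis
  proof (cases "t = n")
    case True
    then have "k = 1" unfolding k_def by simp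
    moreover have "k * (n - t) = 0" "k \<le> k * n" using True t by simp_all
    ultimately show ?thesis using kn unfolding e_def by linarith
  next
    case False
    then have "k * 1 \<le> k * (n - t)" using t by (intro mult_le_mono2) linarith
    then show ?thesis using kn unfolding e_def by linarith
  qed
qed

text \<open>One more agreeing coordinate removes k entries, against k - 1 label conditions. The
  difference of 1 is the factor p that makes conflicts between types rare.\<close>

lemma e_eq:
  assumes "t < n" shows "e = k * (n - (t + 1)) + 1"
proof -
  have "n - t = (n - (t + 1)) + 1" using assms by linarith
  then have "k * (n - t) = k * (n - (t + 1)) + k" by (metis add_mult_distrib2 mult.right_neutral)
  then show ?thesis unfolding e_def by linarith
qed

text \<open>Two kinds of difference spaces have to be separated: vanishing on a t-set with all
  labels 0, and vanishing on a (t+1)-set without label conditions. Both have dimension at most e,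
  and their number explains the bound on p.\<close>

lemma common_hash:
  assumes big: "k + (n choose (t + 1)) < p"
  shows "\<exists>\<phi>::nat \<Rightarrow> nat \<times> nat set \<Rightarrow> int. \<forall>S w.
    (S \<in> TT \<and> (\<forall>T\<in>TT. int p dvd lab T w) \<or> S \<in> ksets n (t + 1)) \<longrightarrow>
    (\<forall>i\<in>S. \<forall>T\<in>TT. int p dvd w (i, T)) \<longrightarrow>
    (\<forall>l<e. int p dvd (\<Sum>i\<in>I. \<phi> l i * w i)) \<longrightarrow> (\<forall>i\<in>I. int p dvd w i)"
proof -
  define J where "J = TT \<union> ksets n (t + 1)"
  define K where "K S = {w. (\<forall>i\<in>S. \<forall>T\<in>TT. int p dvd w (i, T)) \<and>
    (S \<in> TT \<longrightarrow> (\<forall>T\<in>TT. int p dvd lab T w))}" for S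
  have "card J \<le> k + (n choose (t + 1))"
    unfolding J_def using card_Un_le[of TT "ksets n (t + 1)"] card_TT card_ksets[of n "t + 1"] by linarith
  then have J: "finite J" "int (card J) < int p"
    using big finite_TT finite_ksets[of n "t + 1"] by (simp_all add: J_def)
  have grp: "(\<lambda>i. u i + a * v i) \<in> K S" if "u \<in> K S" "v \<in> K S" for S u v a
  proof -
    have "lab T (\<lambda>i. u i + a * v i) = lab T u + a * lab T v" for T
      by (simp add: lab_def sum.distrib sum_distrib_left)
    then show ?thesis using that by (simp add: K_def)
  qed
  have card: "card (residues_on (int p) I ` K S) \<le> nat (int p) ^ e" if S: "S \<in> J" for S
  proof (cases "S \<in> TT")
    case True
    \<comment> \<open>A t-set T other than S has a coordinate outside S, and the label condition at
      T determines the entry there from the others. The label at S gives no further condition, since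
      its entries all lie over S.\<close>
    have "\<exists>i. i \<in> T - S" if "T \<in> TT - {S}" for T
    proof (rule ccontr)
      assume "\<nexists>i. i \<in> T - S"
      then have "T \<subseteq> S" by blast
      then have "T = S" using TT_D[OF True] TT_D[of T] that by (intro card_subset_eq) auto
      then show False using that by blast
    qed
    then obtain f where f: "\<And>T. T \<in> TT - {S} \<Longrightarrow> f T \<in> T - S" by metis
    define I' where "I' = ({1..n} - S) \<times> TT - (\<lambda>T. (f T, T)) ` (TT - {S})"
    have I'I: "I' \<subseteq> I" unfolding I'_def I_def by blast
    then have fI': "finite I'" using finite_I finite_subset by blast
    have "card I' = card (({1..n} - S) \<times> TT) - card ((\<lambda>T. (f T, T)) ` (TT - {S}))"
      unfolding I'_def
    proof (rule card_Diff_subset)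
      show "finite ((\<lambda>T. (f T, T)) ` (TT - {S}))" using finite_TT by simp
      show "(\<lambda>T. (f T, T)) ` (TT - {S}) \<subseteq> ({1..n} - S) \<times> TT"
      proof (rule image_subsetI)
        fix T assume T: "T \<in> TT - {S}"
        then show "(f T, T) \<in> ({1..n} - S) \<times> TT" using f[OF T] TT_D(1)[of T] by blast
      qed
    qed
    also have "card ((\<lambda>T. (f T, T)) ` (TT - {S})) = k - 1"
      using True finite_TT card_TT by (subst card_image) (auto simp: inj_on_def)
    also have "card (({1..n} - S) \<times> TT) = (n - t) * k"
      using TT_D[OF True] card_TT by (simp add: card_cartesian_product card_Diff_subset)
    finally have cI': "card I' = e" using k_pos by (simp add: e_def mult.commute)
    have "card (residues_on (int p) I ` K S) \<le> nat (int p) ^ card I'"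
    proof (rule card_residues_on_le[OF fI' I'I])
      show "0 < int p" using p_pos by simp
      fix u v assume u: "u \<in> K S" and v: "v \<in> K S" and eq: "\<forall>i\<in>I'. int p dvd u i - v i"
      have inS: "int p dvd u (i, T) - v (i, T)" if "i \<in> S" "T \<in> TT" for i T
        using u v that by (auto simp: K_def)
      have other: "int p dvd u (i, T) - v (i, T)" if "(i, T) \<in> I" "T = S \<or> i \<noteq> f T" for i T
      proof (cases "i \<in> S")
        case False
        then have "(i, T) \<in> I'" using that unfolding I'_def I_def by blast
        then show ?thesis using eq by blast
      qed (use inS that in \<open>auto simp: I_def\<close>)
      show "\<forall>i\<in>I. int p dvd u i - v i"
      proof (clarify)
        fix i T assume iT: "(i, T) \<in> I"
        show "int p dvd u (i, T) - v (i, T)"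
        proof (cases "T = S \<or> i \<noteq> f T")
          case False
          have T: "T \<in> TT" using iT by (simp add: I_def)
          have "i \<in> T" using False f[of T] T by blast
          have "int p dvd lab T u - lab T v"
            using u v T True by (intro dvd_diff) (auto simp: K_def)
          also have "lab T u - lab T v = (\<Sum>i\<in>T. u (i, T) - v (i, T))"
            by (simp add: lab_def sum_subtractf)
          also have "\<dots> = (u (i, T) - v (i, T)) + (\<Sum>i\<in>T - {i}. u (i, T) - v (i, T))"
            using TT_D[OF T] \<open>i \<in> T\<close> by (intro sum.remove)
          finally have d: "int p dvd \<dots>" .
          have "int p dvd (\<Sum>i\<in>T - {i}. u (i, T) - v (i, T))"
          proof (rule dvd_sum)
            fix i' assume "i' \<in> T - {i}"
            then show "int p dvd u (i', T) - v (i', T)"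
              using False T TT_D(1)[OF T] by (intro other) (auto simp: I_def)
          qed
          then show ?thesis using d by (simp add: dvd_add_left_iff)
        qed (use other iT in blast)
      qed
    qed
    then show ?thesis by (simp add: cI')
  next
    case False
    then have S': "S \<subseteq> {1..n}" "card S = t + 1" using S unfolding J_def by blast+
    then have "t + 1 \<le> n" using card_mono[of "{1..n}" S] by simp
    define I' where "I' = ({1..n} - S) \<times> TT"
    have I'I: "I' \<subseteq> I" unfolding I'_def I_def by blast
    then have fI': "finite I'" using finite_I finite_subset by blast
    have "finite S" using S'(1) finite_subset by blast
    then have "card I' = k * (n - (t + 1))" unfolding I'_def
      using card_TT S' by (simp add: card_cartesian_product card_Diff_subset mult.commute)
    then have cI': "card I' \<le> e" using e_eq \<open>t + 1 \<le> n\<close> by simp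
    have "card (residues_on (int p) I ` K S) \<le> nat (int p) ^ card I'"
    proof (rule card_residues_on_le[OF fI' I'I])
      show "0 < int p" using p_pos by simp
      fix u v assume u: "u \<in> K S" and v: "v \<in> K S" and eq: "\<forall>i\<in>I'. int p dvd u i - v i"
      show "\<forall>i\<in>I. int p dvd u i - v i"
      proof (clarify)
        fix i T assume iT: "(i, T) \<in> I"
        show "int p dvd u (i, T) - v (i, T)"
        proof (cases "i \<in> S")
          case True
          then show ?thesis using u v iT by (auto simp: K_def I_def)
        next
          case False
          then have "(i, T) \<in> I'" using iT unfolding I'_def I_def by blast
          then show ?thesis using eq by blast
        qed
      qed
    qed
    also have "\<dots> \<le> nat (int p) ^ e" using cI' p_pos by (intro power_increasing) auto
    finally show ?thesis .
  qed
  obtain \<phi> :: "nat \<Rightarrow> nat \<times> nat set \<Rightarrow> int" where \<phi>: "\<forall>S\<in>J. \<forall>w\<in>K S.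
      (\<forall>l<e. int p dvd (\<Sum>i\<in>I. \<phi> l i * w i)) \<longrightarrow> (\<forall>i\<in>I. int p dvd w i)"
    using common_injective_functionals[OF p_pos(2) finite_I J, of K e] grp card by blast
  have "\<forall>i\<in>I. int p dvd w i"
    if "S \<in> TT \<and> (\<forall>T\<in>TT. int p dvd lab T w) \<or> S \<in> ksets n (t + 1)"
       "\<forall>i\<in>S. \<forall>T\<in>TT. int p dvd w (i, T)" "\<forall>l<e. int p dvd (\<Sum>i\<in>I. \<phi> l i * w i)" for S w
  proof -
    have "S \<in> J" using that(1) unfolding J_def by blast
    \<comment> \<open>The sizes t and t + 1 exclude each other, so the label condition in
      \<open>K S\<close> is not triggered for a (t+1)-set.\<close>
    moreover have "S \<in> TT \<longrightarrow> S \<notin> ksets n (t + 1)" using TT_D(2)[of S] by auto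
    then have "w \<in> K S" using that(1,2) unfolding K_def by blast
    ultimately show ?thesis using \<phi> that(3) by blast
  qed
  then show ?thesis by blast
qed

text \<open>For every T the label equation is solved for one entry (f T, T) with f T in T. These k
  entries are distinct and none occurs in another equation, so all remaining entries are
  free.\<close>

lemma card_prescribed_labels:
  "p ^ (k * n - k) \<le> card {x \<in> X. \<forall>T\<in>TT. int p dvd lab T x - \<tau> T}"
proof -
  have "\<exists>i. i \<in> T" if "T \<in> TT" for T
    using TT_D(2)[OF that] t(1) by (metis card.empty ex_in_conv not_one_le_zero)
  then obtain f where f: "\<And>T. T \<in> TT \<Longrightarrow> f T \<in> T" by metis
  define I' where "I' = I - (\<lambda>T. (f T, T)) ` TT"
  have fI': "finite I'" using finite_I by (simp add: I'_def)
  have "card I' = card I - card ((\<lambda>T. (f T, T)) ` TT)"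
    unfolding I'_def
  proof (rule card_Diff_subset)
    show "(\<lambda>T. (f T, T)) ` TT \<subseteq> I"
    proof (rule image_subsetI)
      fix T assume T: "T \<in> TT"
      then show "(f T, T) \<in> I" using f[OF T] TT_D(1)[OF T] unfolding I_def by blast
    qed
  qed (use finite_TT in simp)
  also have "card ((\<lambda>T. (f T, T)) ` TT) = k"
    using card_TT by (subst card_image) (auto simp: inj_on_def)
  finally have cI': "card I' = k * n - k" by (simp add: card_I)
  define g where "g y = (\<lambda>(i, T)\<in>I. if i = f T
     then (\<tau> T - (\<Sum>i\<in>T - {f T}. y (i, T))) mod int p else y (i, T))" for y
  have I'_iff: "(i, T) \<in> I' \<longleftrightarrow> (i, T) \<in> I \<and> i \<noteq> f T" for i T
    unfolding I'_def I_def by auto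
  have "card (I' \<rightarrow>\<^sub>E {0..<int p}) \<le> card {x \<in> X. \<forall>T\<in>TT. int p dvd lab T x - \<tau> T}"
  proof (rule card_inj_on_le)
    show "finite {x \<in> X. \<forall>T\<in>TT. int p dvd lab T x - \<tau> T}" using finite_X by simp
    show "inj_on g (I' \<rightarrow>\<^sub>E {0..<int p})"
    proof (rule inj_onI)
      fix y z assume y: "y \<in> I' \<rightarrow>\<^sub>E {0..<int p}" and z: "z \<in> I' \<rightarrow>\<^sub>E {0..<int p}" and eq: "g y = g z"
      show "y = z"
      proof (rule PiE_ext[OF y z])
        fix i assume "i \<in> I'"
        then obtain j T where i: "i = (j, T)" "(j, T) \<in> I" "j \<noteq> f T" using I'_iff by (cases i) auto
        then have "g y i = y i" "g z i = z i" by (simp_all add: g_def)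
        then show "y i = z i" using eq by simp
      qed
    qed
    show "g ` (I' \<rightarrow>\<^sub>E {0..<int p}) \<subseteq> {x \<in> X. \<forall>T\<in>TT. int p dvd lab T x - \<tau> T}"
    proof (rule image_subsetI, intro CollectI conjI ballI)
      fix y assume y: "y \<in> I' \<rightarrow>\<^sub>E {0..<int p}"
      show "g y \<in> X" unfolding X_def
      proof (rule PiE_I)
        fix i assume "i \<in> I"
        then show "g y i \<in> {0..<int p}"
          using I'_iff PiE_mem[OF y, of i] p_pos(1) by (cases i) (simp add: g_def)
      qed (simp add: g_def)
      fix T assume T: "T \<in> TT"
      have mem: "(i, T) \<in> I" if "i \<in> T" for i using that T TT_D(1)[OF T] unfolding I_def by blast
      have "lab T (g y) = g y (f T, T) + (\<Sum>i\<in>T - {f T}. g y (i, T))"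
        unfolding lab_def using TT_D(3)[OF T] f[OF T] by (rule sum.remove)
      also have "(\<Sum>i\<in>T - {f T}. g y (i, T)) = (\<Sum>i\<in>T - {f T}. y (i, T))"
        using mem by (intro sum.cong) (auto simp: g_def)
      also have "g y (f T, T) = (\<tau> T - (\<Sum>i\<in>T - {f T}. y (i, T))) mod int p"
        using mem[OF f[OF T]] by (simp add: g_def)
      finally have "lab T (g y) - \<tau> T = - ((\<tau> T - (\<Sum>i\<in>T - {f T}. y (i, T)))
          - (\<tau> T - (\<Sum>i\<in>T - {f T}. y (i, T))) mod int p)" by simp
      then show "int p dvd lab T (g y) - \<tau> T" by (simp only: dvd_minus_iff dvd_minus_mod)
    qed
  qed
  then show ?thesis using fI' cI' by (simp add: card_PiE)
qed

lemma card_agree_le: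
  assumes "S \<subseteq> {1..n}"
  shows "card {x \<in> X. agree x y S} \<le> p ^ (k * (n - card S))"
proof -
  have fS: "finite S" using assms finite_subset by blast
  define I' where "I' = ({1..n} - S) \<times> TT"
  have I'I: "I' \<subseteq> I" unfolding I'_def I_def by blast
  then have fI': "finite I'" using finite_I finite_subset by blast
  have cI': "card I' = k * (n - card S)" unfolding I'_def
    using card_TT assms fS by (simp add: card_cartesian_product card_Diff_subset mult.commute)
  have "card {x \<in> X. agree x y S} \<le> card (I' \<rightarrow>\<^sub>E {0..<int p})"
  proof (rule card_inj_on_le)
    show "finite (I' \<rightarrow>\<^sub>E {0..<int p})" using fI' by (simp add: finite_PiE)
    show "(\<lambda>x. restrict x I') ` {x \<in> X. agree x y S} \<subseteq> I' \<rightarrow>\<^sub>E {0..<int p}"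
      using I'I by (auto simp: X_def)
    show "inj_on (\<lambda>x. restrict x I') {x \<in> X. agree x y S}"
    proof (rule inj_onI)
      fix x z assume x: "x \<in> {x \<in> X. agree x y S}" and z: "z \<in> {x \<in> X. agree x y S}"
        and eq: "restrict x I' = restrict z I'"
      have "x i = z i" if i: "i \<in> I" for i
      proof (cases "i \<in> I'")
        case True
        then show ?thesis using eq by (metis restrict_apply')
      next
        case False
        then have "fst i \<in> S" "snd i \<in> TT" using i by (auto simp: I_def I'_def)
        then show ?thesis using x z unfolding agree_def by (metis (mono_tags, lifting) mem_Collect_eq prod.collapse)
      qed
      then show "x = z" using x z PiE_ext[of x I "\<lambda>_. {0..<int p}" z] by (simp add: X_def)
    qed
  qed
  then show ?thesis using fI' cI' by (simp add: card_PiE)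
qed

section \<open>Codes with reserved label intervals\<close>

text \<open>The types are added one at a time: the pigeonhole principle picks a hash value for which few
  words of the new type agree with an earlier word in t+1 coordinates, and those are discarded.\<close>

lemma exists_typed_code:
  fixes P :: "'c set" and Ow :: "'c \<Rightarrow> nat set set" and L R :: nat
  assumes P: "finite P" and Ow: "\<And>\<pi>. \<pi> \<in> P \<Longrightarrow> Ow \<pi> \<subseteq> TT" "\<And>\<pi>. \<pi> \<in> P \<Longrightarrow> Ow \<pi> \<noteq> {}"
    and R: "\<And>T. T \<in> TT \<Longrightarrow> card {\<pi>\<in>P. T \<in> Ow \<pi>} = R"
    and LR: "L * R < p" and big: "k + (n choose (t + 1)) < p"
  shows "\<exists>D. (\<forall>\<pi>\<in>P. D \<pi> \<subseteq> X \<and>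
        L * p ^ (k * t) \<le> p * card (D \<pi>) + card P * (n choose (t + 1)) * p ^ (k * t)) \<and>
      (\<forall>\<pi>\<in>P. \<forall>\<sigma>\<in>P. \<forall>x\<in>D \<pi>. \<forall>y\<in>D \<sigma>.
        (\<exists>S\<in>Ow \<pi> \<union> ksets n (t + 1). agree x y S) \<longrightarrow> \<pi> = \<sigma> \<and> x = y)"
proof -
  \<comment> \<open>At each T the R types owning it are numbered from 0; number j reserves the
    labels from 1 + j * L to (j + 1) * L.\<close>
  have "\<forall>T\<in>TT. \<exists>f. bij_betw f {\<pi>\<in>P. T \<in> Ow \<pi>} {0..<R}"
  proof
    fix T assume T: "T \<in> TT"
    have "finite {\<pi>\<in>P. T \<in> Ow \<pi>}" using P by simp
    from ex_bij_betw_finite_nat[OF this] show "\<exists>f. bij_betw f {\<pi>\<in>P. T \<in> Ow \<pi>} {0..<R}"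
      using R[OF T] by simp
  qed
  then obtain idx where idx: "\<And>T. T \<in> TT \<Longrightarrow> bij_betw (idx T) {\<pi>\<in>P. T \<in> Ow \<pi>} {0..<R}" by metis
  obtain \<phi> :: "nat \<Rightarrow> nat \<times> nat set \<Rightarrow> int" where \<phi>: "\<And>S w.
    (S \<in> TT \<and> (\<forall>T\<in>TT. int p dvd lab T w) \<or> S \<in> ksets n (t + 1)) \<Longrightarrow>
    (\<forall>i\<in>S. \<forall>T\<in>TT. int p dvd w (i, T)) \<Longrightarrow>
    (\<forall>l<e. int p dvd (\<Sum>i\<in>I. \<phi> l i * w i)) \<Longrightarrow> (\<forall>i\<in>I. int p dvd w i)"
    using common_hash[OF big] by blast
  \<comment> \<open>The summand 1 keeps the reserved intervals apart from 0, the common label of all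
    sets that are not own.\<close>
  define tgt where "tgt \<pi> z T = (if T \<in> Ow \<pi> then 1 + idx T \<pi> * L + z else 0)" for \<pi> z T
  define B where "B \<pi> z = {x \<in> X. \<forall>T\<in>TT. int p dvd lab T x - int (tgt \<pi> z T)}" for \<pi> z
  define A where "A \<pi> = (\<Union>z<L. B \<pi> z)" for \<pi>
  define H where "H x = (\<lambda>l\<in>{..<e}. (\<Sum>i\<in>I. \<phi> l i * x i) mod int p)" for x
  have AX: "A \<pi> \<subseteq> X" for \<pi> by (auto simp: A_def B_def)
  then have finA: "finite (A \<pi>)" for \<pi> using finite_X finite_subset by blast

  have idx_less: "idx T \<pi> < R" if "\<pi> \<in> P" "T \<in> Ow \<pi>" for T \<pi>
  proof -
    have "T \<in> TT" using Ow(1)[OF that(1)] that(2) by blast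
    then have "idx T \<pi> \<in> {0..<R}" using that by (intro bij_betw_apply[OF idx]) simp_all
    then show ?thesis by simp
  qed
  have tgt_less: "tgt \<pi> z T < p" if "\<pi> \<in> P" "z < L" for \<pi> z T
  proof (cases "T \<in> Ow \<pi>")
    case True
    then have "(idx T \<pi> + 1) * L \<le> R * L"
      using idx_less[OF that(1) True] by (intro mult_le_mono1) simp
    moreover have "(idx T \<pi> + 1) * L = idx T \<pi> * L + L" by simp
    moreover have "R * L < p" using LR by (simp add: mult.commute)
    ultimately have "1 + idx T \<pi> * L + z < p" using that(2) by linarith
    then show ?thesis using True by (simp add: tgt_def)
  qed (use p_pos in \<open>simp add: tgt_def\<close>)
  have tgt_eq: "tgt \<pi> z T = tgt \<sigma> z' T"
    if "\<pi> \<in> P" "\<sigma> \<in> P" "z < L" "z' < L" "x \<in> B \<pi> z" "y \<in> B \<sigma> z'" "T \<in> TT" "agree x y T"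
    for \<pi> \<sigma> z z' x y T
  proof -
    have "lab T x = lab T y" using that(7,8) unfolding lab_def agree_def by (intro sum.cong) auto
    moreover have "int p dvd lab T x - int (tgt \<pi> z T)" "int p dvd lab T y - int (tgt \<sigma> z' T)"
      using that unfolding B_def by blast+
    ultimately have "int p dvd (lab T y - int (tgt \<sigma> z' T)) - (lab T y - int (tgt \<pi> z T))"
      by (metis dvd_diff)
    then have "int p dvd int (tgt \<pi> z T) - int (tgt \<sigma> z' T)" by (simp add: algebra_simps)
    then have "int (tgt \<pi> z T) = int (tgt \<sigma> z' T)"
      using tgt_less that by (intro eq_of_dvd_diff) auto
    then show ?thesis by simp
  qed
  \<comment> \<open>A nonzero label shows that T is own for the second type as well. Division by L
    recovers the number of the type at T, and then the offset follows.\<close>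
  have own_agree: "\<pi> = \<sigma> \<and> z = z'"
    if "\<pi> \<in> P" "\<sigma> \<in> P" "z < L" "z' < L" "x \<in> B \<pi> z" "y \<in> B \<sigma> z'" "T \<in> Ow \<pi>" "agree x y T"
    for \<pi> \<sigma> z z' x y T
  proof -
    have T: "T \<in> TT" using Ow(1) that by blast
    have eq: "tgt \<pi> z T = tgt \<sigma> z' T" using tgt_eq that T by blast
    then have T': "T \<in> Ow \<sigma>" using that(7) by (auto simp: tgt_def split: if_splits)
    then have eq': "idx T \<pi> * L + z = idx T \<sigma> * L + z'" using that(7) eq by (simp add: tgt_def)
    have "(idx T \<pi> * L + z) div L = idx T \<pi>" "(idx T \<sigma> * L + z') div L = idx T \<sigma>"
      using that(3,4) by simp_all
    then have ii: "idx T \<pi> = idx T \<sigma>" using eq' by simp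
    then have "z = z'" using eq' by simp
    moreover have "\<pi> = \<sigma>"
      using bij_betw_imp_inj_on[OF idx[OF T]] ii that T' by (auto simp: inj_on_def)
    ultimately show ?thesis by simp
  qed
  have cross: "\<pi> = \<sigma>" if "\<pi> \<in> P" "\<sigma> \<in> P" "x \<in> A \<pi>" "y \<in> A \<sigma>" "T \<in> Ow \<pi>" "agree x y T"
    for \<pi> \<sigma> x y T
    using own_agree[OF that(1,2) _ _ _ _ that(5,6)] that(3,4) unfolding A_def by blast
  \<comment> \<open>The hash enters here. Within one type, agreement on an own set fixes the offset
    and hence all labels, so the difference lies in a space on which the hash is injective. On a
    (t+1)-set the offsets may differ.\<close>
  have same: "x = y"
    if \<pi>: "\<pi> \<in> P" and x: "x \<in> A \<pi>" and y: "y \<in> A \<pi>" and Heq: "H x = H y"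
      and S: "S \<in> Ow \<pi> \<union> ksets n (t + 1)" and ag: "agree x y S"
    for \<pi> x y S
  proof -
    define w where "w i = x i - y i" for i
    obtain z z' where z: "z < L" "x \<in> B \<pi> z" "z' < L" "y \<in> B \<pi> z'"
      using x y unfolding A_def by blast
    have "S \<in> TT \<and> (\<forall>T\<in>TT. int p dvd lab T w) \<or> S \<in> ksets n (t + 1)"
    proof (cases "S \<in> Ow \<pi>")
      case True
      then have "z = z'" using own_agree[OF \<pi> \<pi> z(1,3,2,4)] ag by blast
      have "int p dvd lab T w" if "T \<in> TT" for T
      proof -
        have "int p dvd lab T x - int (tgt \<pi> z T)" "int p dvd lab T y - int (tgt \<pi> z T)"
          using z that \<open>z = z'\<close> unfolding B_def by blast+
        then have "int p dvd (lab T x - int (tgt \<pi> z T)) - (lab T y - int (tgt \<pi> z T))"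
          by (rule dvd_diff)
        moreover have "lab T w = lab T x - lab T y" by (simp add: lab_def w_def sum_subtractf)
        ultimately show ?thesis by simp
      qed
      then show ?thesis using Ow(1)[OF \<pi>] True by blast
    qed (use S in blast)
    moreover have "\<forall>i\<in>S. \<forall>T\<in>TT. int p dvd w (i, T)" using ag by (simp add: agree_def w_def)
    moreover have "\<forall>l<e. int p dvd (\<Sum>i\<in>I. \<phi> l i * w i)"
    proof (intro allI impI)
      fix l assume "l < e"
      then have "(\<Sum>i\<in>I. \<phi> l i * x i) mod int p = (\<Sum>i\<in>I. \<phi> l i * y i) mod int p"
        using fun_cong[OF Heq, of l] by (simp add: H_def)
      then have "int p dvd (\<Sum>i\<in>I. \<phi> l i * x i) - (\<Sum>i\<in>I. \<phi> l i * y i)"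
        by (simp add: mod_eq_dvd_iff)
      then show "int p dvd (\<Sum>i\<in>I. \<phi> l i * w i)"
        by (simp add: w_def right_diff_distrib sum_subtractf)
    qed
    ultimately have d: "\<forall>i\<in>I. int p dvd x i - y i" unfolding w_def[symmetric] by (rule \<phi>)
    have xX: "x \<in> I \<rightarrow>\<^sub>E {0..<int p}" and yX: "y \<in> I \<rightarrow>\<^sub>E {0..<int p}"
      using x y AX unfolding X_def by blast+
    show "x = y"
    proof (rule PiE_ext[OF xX yX])
      fix i assume i: "i \<in> I"
      show "x i = y i" using eq_of_dvd_diff[OF _ PiE_mem[OF xX i] PiE_mem[OF yX i]] d i by blast
    qed
  qed

  have cardA: "L * p ^ (k * n - k) \<le> card (A \<pi>)" if \<pi>: "\<pi> \<in> P" for \<pi>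
  proof -
    obtain T where T: "T \<in> Ow \<pi>" using Ow(2)[OF \<pi>] by blast
    have "(\<Sum>z<L. p ^ (k * n - k)) \<le> (\<Sum>z<L. card (B \<pi> z))"
      unfolding B_def by (intro sum_mono card_prescribed_labels)
    also have "\<dots> = card (A \<pi>)" unfolding A_def
    proof (rule card_UN_disjoint[symmetric])
      show "\<forall>z\<in>{..<L}. finite (B \<pi> z)" using finite_X by (simp add: B_def)
      show "\<forall>z\<in>{..<L}. \<forall>z'\<in>{..<L}. z \<noteq> z' \<longrightarrow> B \<pi> z \<inter> B \<pi> z' = {}"
      proof (intro ballI impI, rule ccontr)
        fix z z' assume z: "z \<in> {..<L}" "z' \<in> {..<L}" "z \<noteq> z'" "B \<pi> z \<inter> B \<pi> z' \<noteq> {}"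
        then obtain x where x: "x \<in> B \<pi> z" "x \<in> B \<pi> z'" by blast
        have "agree x x T" by (simp add: agree_def)
        then show False using own_agree[OF \<pi> \<pi> _ _ x T] z by simp
      qed
    qed simp
    finally show ?thesis by simp
  qed
  \<comment> \<open>Words of one type with a common hash value are determined by their symbols on
    any own set. This limits the size of each finished type and thereby the conflicts it causes for
    later ones.\<close>
  have card_le: "card D \<le> p ^ (k * t)"
    if \<pi>: "\<pi> \<in> P" and D: "D \<subseteq> A \<pi>" "\<And>x y. x \<in> D \<Longrightarrow> y \<in> D \<Longrightarrow> H x = H y" for \<pi> D
  proof -
    obtain T where T: "T \<in> Ow \<pi>" using Ow(2)[OF \<pi>] by blast
    then have T': "T \<in> TT" using Ow(1)[OF \<pi>] by blast
    have sub: "T \<times> TT \<subseteq> I" using TT_D(1)[OF T'] unfolding I_def by blast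
    have fin: "finite (T \<times> TT)" using TT_D(3)[OF T'] finite_TT by simp
    have "card D \<le> card (T \<times> TT \<rightarrow>\<^sub>E {0..<int p})"
    proof (rule card_inj_on_le)
      show "finite (T \<times> TT \<rightarrow>\<^sub>E {0..<int p})" using fin by (simp add: finite_PiE)
      show "(\<lambda>x. restrict x (T \<times> TT)) ` D \<subseteq> T \<times> TT \<rightarrow>\<^sub>E {0..<int p}"
      proof (rule image_subsetI)
        fix x assume "x \<in> D"
        then have "x \<in> I \<rightarrow>\<^sub>E {0..<int p}" using D(1) AX unfolding X_def by blast
        then have "x i \<in> {0..<int p}" if "i \<in> T \<times> TT" for i using that sub by (meson PiE_mem subsetD)
        then show "restrict x (T \<times> TT) \<in> T \<times> TT \<rightarrow>\<^sub>E {0..<int p}" 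
          unfolding restrict_PiE_iff by blast
      qed
      show "inj_on (\<lambda>x. restrict x (T \<times> TT)) D"
      proof (rule inj_onI)
        fix x y assume xy: "x \<in> D" "y \<in> D" "restrict x (T \<times> TT) = restrict y (T \<times> TT)"
        have "agree x y T" unfolding agree_def
        proof (intro ballI)
          fix i S assume "i \<in> T" "S \<in> TT"
          then show "x (i, S) = y (i, S)" using fun_cong[OF xy(3), of "(i, S)"] by simp
        qed
        then show "x = y" using same[OF \<pi> _ _ D(2)[OF xy(1,2)]] xy D(1) T by blast
      qed
    qed
    then show ?thesis using fin TT_D(2)[OF T'] card_TT
      by (simp add: card_PiE card_cartesian_product mult.commute)
  qed
  have conflict: "p * card {x \<in> X. agree x y S} \<le> p ^ e" if S: "S \<in> ksets n (t + 1)" for y S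
  proof -
    have S': "S \<subseteq> {1..n}" "card S = t + 1" using S by blast+
    then have "t < n" using card_mono[of "{1..n}" S] by simp
    then have "p ^ e = p * p ^ (k * (n - card S))" using e_eq S' by simp
    then show ?thesis using card_agree_le[OF S'(1), of y] by simp
  qed

  \<comment> \<open>Across types the invariant only asks for disagreement on (t+1)-sets: own sets
    are settled by the labels through \<open>cross\<close>, and pairs within a type by the common
    hash value through \<open>same\<close>.\<close>
  define good where "good Q D \<longleftrightarrow> (\<forall>\<pi>\<in>Q. D \<pi> \<subseteq> A \<pi>) \<and>
      (\<forall>\<pi>\<in>Q. \<forall>x\<in>D \<pi>. \<forall>y\<in>D \<pi>. H x = H y) \<and>
      (\<forall>\<pi>\<in>Q. L * p ^ (k * t) \<le> p * card (D \<pi>) + card P * (n choose (t + 1)) * p ^ (k * t)) \<and>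
      (\<forall>\<pi>\<in>Q. \<forall>\<sigma>\<in>Q. \<forall>x\<in>D \<pi>. \<forall>y\<in>D \<sigma>. \<forall>S\<in>ksets n (t + 1). \<pi> \<noteq> \<sigma> \<longrightarrow> \<not> agree x y S)"
    for Q D
  have good1: "D \<sigma> \<subseteq> A \<sigma>" if "good Q D" "\<sigma> \<in> Q" for Q D \<sigma>
    using that unfolding good_def by blast
  have good2: "H x = H y" if "good Q D" "\<sigma> \<in> Q" "x \<in> D \<sigma>" "y \<in> D \<sigma>" for Q D \<sigma> x y
    using that unfolding good_def by blast
  have good3: "L * p ^ (k * t) \<le> p * card (D \<sigma>) + card P * (n choose (t + 1)) * p ^ (k * t)"
    if "good Q D" "\<sigma> \<in> Q" for Q D \<sigma>
    using that unfolding good_def by blast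
  have good4: "\<not> agree x y S"
    if "good Q D" "\<rho> \<in> Q" "\<sigma> \<in> Q" "x \<in> D \<rho>" "y \<in> D \<sigma>" "S \<in> ksets n (t + 1)" "\<rho> \<noteq> \<sigma>"
    for Q D \<rho> \<sigma> x y S
    using that unfolding good_def by (elim conjE) (drule (1) bspec, drule (1) bspec, drule (1) bspec,
        drule (1) bspec, drule (1) bspec, drule (1) mp)

  have "\<exists>D. good Q D"
    if "Q \<subseteq> P" for Q
    using finite_subset[OF that P] that
  proof (induction Q rule: finite_induct)
    case empty
    show ?case by (simp add: good_def)
  next
    case (insert \<pi> Q)
    have \<pi>: "\<pi> \<in> P" and Q: "Q \<subseteq> P" using insert.prems by simp_all
    obtain D where D: "good Q D" using insert.IH[OF Q] by blast
    define Y where "Y = (\<Union>\<sigma>\<in>Q. D \<sigma>)"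
    have "card Y \<le> (\<Sum>\<sigma>\<in>Q. card (D \<sigma>))" unfolding Y_def by (rule card_UN_le[OF insert.hyps(1)])
    also have "\<dots> \<le> (\<Sum>\<sigma>\<in>Q. p ^ (k * t))"
    proof (rule sum_mono)
      fix \<sigma> assume "\<sigma> \<in> Q"
      then show "card (D \<sigma>) \<le> p ^ (k * t)"
        using Q good1[OF D] good2[OF D] by (intro card_le[of \<sigma>]) blast+
    qed
    also have "\<dots> \<le> card P * p ^ (k * t)"
      using card_mono[OF P Q] by simp
    finally have cardY: "card Y \<le> card P * p ^ (k * t)" .
    have finY: "finite Y" unfolding Y_def
      using insert.hyps(1) finite_subset[OF good1[OF D] finA] by (intro finite_UN_I)
    define W where "W = Y \<times> ksets n (t + 1)"
    have finW: "finite W" using finY finite_ksets[of n "t + 1"] by (simp add: W_def)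
    define Bad where "Bad = (\<Union>(y, S)\<in>W. {x \<in> X. agree x y S})"
    define Good where "Good = A \<pi> - Bad"
    have "p * card Bad \<le> p * (\<Sum>(y, S)\<in>W. card {x \<in> X. agree x y S})"
      unfolding Bad_def using card_UN_le[OF finW, of "\<lambda>(y, S). {x \<in> X. agree x y S}"]
      by (simp add: case_prod_unfold)
    also have "\<dots> = (\<Sum>(y, S)\<in>W. p * card {x \<in> X. agree x y S})"
      by (simp add: sum_distrib_left case_prod_unfold)
    also have "\<dots> \<le> (\<Sum>(y, S)\<in>W. p ^ e)"
    proof (rule sum_mono, clarify)
      fix y S assume "(y, S) \<in> W"
      then have "S \<in> ksets n (t + 1)" unfolding W_def by blast
      then show "p * card {x \<in> X. agree x y S} \<le> p ^ e" by (rule conflict)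
    qed
    also have "\<dots> = card Y * (n choose (t + 1)) * p ^ e"
      unfolding W_def by (simp only: case_prod_unfold sum_constant card_cartesian_product card_ksets of_nat_id)
    also have "\<dots> \<le> card P * p ^ (k * t) * (n choose (t + 1)) * p ^ e"
      using cardY by (intro mult_le_mono1)
    finally have bad: "p * card Bad \<le> card P * p ^ (k * t) * (n choose (t + 1)) * p ^ e" .
    have finBad: "finite Bad" unfolding Bad_def using finW finite_X by auto
    have "card (A \<pi>) \<le> card (Good \<union> Bad)"
      unfolding Good_def using finA finBad by (intro card_mono) auto
    also have "\<dots> \<le> card Good + card Bad" by (rule card_Un_le)
    finally have cA: "card (A \<pi>) \<le> card Good + card Bad" .
    \<comment> \<open>All conflicting words are removed before the hash value is chosen, so a single
      averaging over \<open>Good\<close> accounts for the deletions as well.\<close>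
    have "\<exists>b\<in>{..<e} \<rightarrow>\<^sub>E {0..<int p}. card Good \<le> card ({..<e} \<rightarrow>\<^sub>E {0..<int p}) * card {x\<in>Good. H x = b}"
    proof (rule exists_large_fibre)
      show "finite Good" using finA by (simp add: Good_def)
      show "finite ({..<e} \<rightarrow>\<^sub>E {0..<int p})" by (simp add: finite_PiE)
      show "{..<e} \<rightarrow>\<^sub>E {0..<int p} \<noteq> {}" using p_pos by (simp add: PiE_eq_empty_iff)
      show "H ` Good \<subseteq> {..<e} \<rightarrow>\<^sub>E {0..<int p}" 
        unfolding H_def using p_pos(1) by (intro image_subsetI) (simp only: restrict_PiE_iff, simp)
    qed
    then obtain b where b: "card Good \<le> p ^ e * card {x\<in>Good. H x = b}"
      by (auto simp: card_PiE)
    define E where "E = {x\<in>Good. H x = b}"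
    \<comment> \<open>Both sides carry the factor p^e until the end, so that averaging over hash
      values needs no division in the natural numbers.\<close>
    have "p ^ e * (L * p ^ (k * t)) = p * (L * p ^ (k * n - k))"
    proof -
      have "p ^ e * p ^ (k * t) = p * p ^ (k * n - k)"
        using exponent_eq by (metis power_add add.commute power_Suc Suc_eq_plus1)
      then show ?thesis by (metis mult.left_commute)
    qed
    also have "\<dots> \<le> p * (card Good + card Bad)"
      using cardA[OF \<pi>] cA by (intro mult_le_mono2) linarith
    also have "\<dots> \<le> p * (p ^ e * card E) + card P * p ^ (k * t) * (n choose (t + 1)) * p ^ e"
      using bad b mult_le_mono2[OF b, of p] by (simp only: add_mult_distrib2 E_def) 
    also have "\<dots> = p ^ e * (p * card E + card P * (n choose (t + 1)) * p ^ (k * t))"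
      by (simp add: algebra_simps)
    finally have E_card: "L * p ^ (k * t) \<le> p * card E + card P * (n choose (t + 1)) * p ^ (k * t)"
      using p_pos by simp
    have EA: "E \<subseteq> A \<pi>" and EH: "\<And>x y. x \<in> E \<Longrightarrow> y \<in> E \<Longrightarrow> H x = H y"
      unfolding E_def Good_def by auto
    have Ebad: "\<not> agree x y S" if "x \<in> E" "y \<in> D \<sigma>" "\<sigma> \<in> Q" "S \<in> ksets n (t + 1)" for x y S \<sigma>
    proof
      assume "agree x y S"
      moreover have "(y, S) \<in> W" using that unfolding W_def Y_def by blast
      moreover have "x \<in> X" "x \<notin> Bad" using that(1) AX unfolding E_def Good_def by blast+
      ultimately show False unfolding Bad_def by blast
    qed
    have sym: "agree x y S \<longleftrightarrow> agree y x S" for x y S by (auto simp: agree_def)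
    have ne: "\<sigma> \<noteq> \<pi>" if "\<sigma> \<in> Q" for \<sigma> using that insert.hyps(2) by blast
    have "good (insert \<pi> Q) (D(\<pi> := E))" unfolding good_def
    proof (intro conjI ballI impI)
      fix \<sigma> assume s: "\<sigma> \<in> insert \<pi> Q"
      show "(D(\<pi> := E)) \<sigma> \<subseteq> A \<sigma>"
      proof (cases "\<sigma> = \<pi>")
        case False
        then show ?thesis using s good1[OF D, of \<sigma>] by simp
      qed (use EA in simp)
      show "L * p ^ (k * t) \<le> p * card ((D(\<pi> := E)) \<sigma>) + card P * (n choose (t + 1)) * p ^ (k * t)"
      proof (cases "\<sigma> = \<pi>")
        case False
        then show ?thesis using s good3[OF D, of \<sigma>] by simp
      qed (use E_card in simp)
      fix x y assume "x \<in> (D(\<pi> := E)) \<sigma>" "y \<in> (D(\<pi> := E)) \<sigma>"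
      then show "H x = H y" using s EH[of x y] good2[OF D, of \<sigma> x y] by (cases "\<sigma> = \<pi>") simp_all
    next
      fix \<rho> \<sigma> x y S
      assume rs: "\<rho> \<in> insert \<pi> Q" "\<sigma> \<in> insert \<pi> Q" "\<rho> \<noteq> \<sigma>"
        and x: "x \<in> (D(\<pi> := E)) \<rho>" and y: "y \<in> (D(\<pi> := E)) \<sigma>" and S: "S \<in> ksets n (t + 1)"
      consider "\<rho> = \<pi>" "\<sigma> \<in> Q" | "\<sigma> = \<pi>" "\<rho> \<in> Q" | "\<rho> \<in> Q" "\<sigma> \<in> Q" using rs by blast
      then show "\<not> agree x y S"
      proof cases
        case 1
        then have "x \<in> E" "y \<in> D \<sigma>" using x y ne by simp_all
        then show ?thesis using Ebad[OF _ _ 1(2) S] by blast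
      next
        case 2
        then have "y \<in> E" "x \<in> D \<rho>" using x y ne by simp_all
        then show ?thesis using Ebad[OF _ _ 2(2) S] sym by blast
      next
        case 3
        then have "x \<in> D \<rho>" "y \<in> D \<sigma>" using x y ne by simp_all
        then show ?thesis using good4[OF D 3 _ _ S rs(3)] by blast
      qed
    qed
    then show ?case by blast
  qed
  from this[OF subset_refl] obtain D where D: "good P D" by blast
  have "\<pi> = \<sigma> \<and> x = y" if \<pi>: "\<pi> \<in> P" and \<sigma>: "\<sigma> \<in> P" and x: "x \<in> D \<pi>" and y: "y \<in> D \<sigma>"
    and S: "S \<in> Ow \<pi> \<union> ksets n (t + 1)" and ag: "agree x y S" for \<pi> \<sigma> x y S
  proof -
    have xA: "x \<in> A \<pi>" and yA: "y \<in> A \<sigma>" using x y good1[OF D] \<pi> \<sigma> by blast+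
    have "\<pi> = \<sigma>"
    proof (cases "S \<in> Ow \<pi>")
      case True
      then show ?thesis using cross[OF \<pi> \<sigma> xA yA _ ag] by blast
    next
      case False
      then have "S \<in> ksets n (t + 1)" using S by blast
      then show ?thesis using good4[OF D \<pi> \<sigma> x y] ag by blast
    qed
    moreover from this have "x = y"
      using same[OF \<pi> xA _ _ S ag] yA good2[OF D \<pi> x] y by blast
    ultimately show ?thesis by blast
  qed
  moreover have "D \<pi> \<subseteq> X" if "\<pi> \<in> P" for \<pi> using good1[OF D that] AX by blast
  ultimately show ?thesis using good3[OF D] by (intro exI[of _ D] conjI ballI impI; (elim bexE)?) blast+
qed

end

section \<open>Reed-Solomon codes over the integers modulo N\<close>

text \<open>Linear factors are split off over the integers: evaluating p = (X - a) q + p(a) at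
  another root x shows that N divides (x - a) q(x), where x - a is a unit mod N. This replaces the
  root bound over a field. The case \<open>p = 0\<close> is what remains when no roots are
  left.\<close>

lemma const_dvd_poly_of_roots_mod:
  fixes N :: int and p :: "int poly"
  assumes "finite S" "p = 0 \<or> degree p < card S" "\<And>x. x \<in> S \<Longrightarrow> N dvd poly p x"
    and "\<And>x y. x \<in> S \<Longrightarrow> y \<in> S \<Longrightarrow> x \<noteq> y \<Longrightarrow> coprime N (x - y)"
  shows "[:N:] dvd p"
  using assms
proof (induction S arbitrary: p rule: finite_induct)
  case empty
  then show ?case by simp
next
  case (insert a S)
  define q where "q = synthetic_div p a"
  have p: "p = [:- a, 1:] * q + [:poly p a:]"
    using synthetic_div_correct'[of a p] by (simp add: q_def)
  have "q = 0 \<or> degree q < card S"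
  proof (cases "degree p = 0")
    case True
    then show ?thesis by (simp add: q_def synthetic_div_eq_0_iff)
  next
    case False
    then have "degree p < card (insert a S)" using insert.prems(1) by auto
    then have "degree p - 1 < card S" using insert.hyps False by simp
    then show ?thesis by (simp add: q_def degree_synthetic_div)
  qed
  moreover have "N dvd poly q x" if x: "x \<in> S" for x
  proof -
    have "poly p x = (x - a) * poly q x + poly p a" by (subst p) (simp add: algebra_simps)
    moreover have "N dvd poly p x" "N dvd poly p a" using insert.prems(2) x by blast+
    ultimately have "N dvd (x - a) * poly q x" by (metis dvd_add_left_iff)
    moreover have "coprime N (x - a)" using insert.prems(3) x insert.hyps(2) by blast
    ultimately show ?thesis by (simp add: coprime_dvd_mult_right_iff)
  qed
  ultimately have "[:N:] dvd q" using insert.IH insert.prems(3) by blast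
  moreover have "[:N:] dvd [:poly p a:]"
    using insert.prems(2)[of a] by (simp add: const_poly_dvd_iff coeff_pCons split: nat.split)
  ultimately show ?case by (metis p dvd_add dvd_mult)
qed

text \<open>Polynomials of degree below t are evaluated at 1, ..., n. Differences of distinct points
  divide n! and so are units mod N. Admitting composite N makes every N congruent to 1 mod n!
  usable, and the gaps between such N are bounded.\<close>

lemma exists_mds_code:
  fixes n t N :: nat
  assumes N: "coprime N (fact n)" "N \<ge> 1" and t: "1 \<le> t" "t \<le> n"
  shows "\<exists>V. V \<subseteq> {1..n} \<rightarrow>\<^sub>E {..<N} \<and> card V = N ^ t \<and>
     (\<forall>u\<in>V. \<forall>v\<in>V. u \<noteq> v \<longrightarrow> card {i\<in>{1..n}. v i = u i} < t)"
proof -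
  define f where "f a = (\<Sum>j<t. monom (int (a j)) j)" for a :: "nat \<Rightarrow> nat"
  define w where "w a = (\<lambda>i\<in>{1..n}. nat (poly (f a) (int i) mod int N))" for a
  define D where "D = {..<t} \<rightarrow>\<^sub>E {..<N}"
  have coeff: "coeff (f a) j = (if j < t then int (a j) else 0)" for a j
    by (simp add: f_def coeff_sum)
  have key: "a = b" if a: "a \<in> D" and b: "b \<in> D" and ag: "t \<le> card {i\<in>{1..n}. w b i = w a i}" for a b
  proof -
    define S where "S = int ` {i\<in>{1..n}. w b i = w a i}"
    have cS: "t \<le> card S" using ag by (simp add: S_def card_image)
    have "[:int N:] dvd f b - f a"
    proof (rule const_dvd_poly_of_roots_mod)
      show "finite S" by (simp add: S_def)
      have "degree (f b - f a) \<le> t - 1"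
      proof (intro degree_le allI impI)
        fix i assume "t - 1 < i"
        then have "\<not> i < t" by linarith
        then show "coeff (f b - f a) i = 0" by (simp add: coeff)
      qed
      then show "f b - f a = 0 \<or> degree (f b - f a) < card S" using cS t(1) by linarith
      show "int N dvd poly (f b - f a) x" if x: "x \<in> S" for x
      proof -
        obtain i where i: "i \<in> {1..n}" "w b i = w a i" "x = int i" using x unfolding S_def by blast
        then have "nat (poly (f b) x mod int N) = nat (poly (f a) x mod int N)" by (simp add: w_def)
        then have "poly (f b) x mod int N = poly (f a) x mod int N" using N(2) by (simp add: nat_eq_iff)
        then show ?thesis by (simp add: mod_eq_dvd_iff)
      qed
      show "coprime (int N) (x - y)" if xy: "x \<in> S" "y \<in> S" "x \<noteq> y" for x y
      proof -
        obtain i j where ij: "i \<in> {1..n}" "j \<in> {1..n}" "x = int i" "y = int j"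
          using xy unfolding S_def by blast
        define d where "d = nat \<bar>x - y\<bar>"
        have "1 \<le> d" "d \<le> n" using ij xy(3) by (auto simp: d_def)
        then have "d dvd fact n" by (rule dvd_fact)
        then have "coprime N d" using N(1) coprime_divisors[of N N d "fact n"] by simp
        then have "coprime (int N) (int d)" by simp
        then show ?thesis by (simp add: d_def)
      qed
    qed
    then have dv: "\<forall>j. int N dvd coeff (f b - f a) j" by (simp add: const_poly_dvd_iff)
    show "a = b"
    proof (rule PiE_ext[OF a[unfolded D_def] b[unfolded D_def]])
      fix j assume j: "j \<in> {..<t}"
      have "a j < N" "b j < N" using j a b by (auto simp: D_def)
      moreover have "int N dvd int (b j) - int (a j)" using dv[rule_format, of j] j by (simp add: coeff)
      ultimately show "a j = b j" using eq_of_dvd_diff[of "int N" "int (b j)" "int (a j)"] by simp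
    qed
  qed
  have "w ` D \<subseteq> {1..n} \<rightarrow>\<^sub>E {..<N}"
    unfolding w_def using N(2) by (intro image_subsetI) (simp only: restrict_PiE_iff, simp add: nat_less_iff)
  moreover have "card (w ` D) = N ^ t"
  proof -
    have "inj_on w D"
    proof (rule inj_onI)
      fix a b assume ab: "a \<in> D" "b \<in> D" "w a = w b"
      have "{i\<in>{1..n}. w b i = w a i} = {1..n}" unfolding ab(3) by blast
      then have "card {i\<in>{1..n}. w b i = w a i} = n" by (simp only: card_atLeastAtMost diff_Suc_1)
      then show "a = b" using key[OF ab(1,2)] t(2) by linarith
    qed
    then show ?thesis by (simp add: card_image D_def card_PiE)
  qed
  moreover have "\<forall>u\<in>w ` D. \<forall>v\<in>w ` D. u \<noteq> v \<longrightarrow> card {i\<in>{1..n}. v i = u i} < t"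
  proof (intro ballI impI, rule ccontr)
    fix u v assume uv: "u \<in> w ` D" "v \<in> w ` D" "u \<noteq> v" "\<not> card {i\<in>{1..n}. v i = u i} < t"
    then obtain a b where ab: "a \<in> D" "b \<in> D" "u = w a" "v = w b" by blast
    then have "a = b" using key[OF ab(1,2)] uv(4) by (simp only: not_less)
    then show False using uv(3) ab by simp
  qed
  ultimately show ?thesis by (intro exI[of _ "w ` D"]) blast
qed

text \<open>The permutation may depend on the word, while F is fixed. The symbol type is left open
  because the symbols over a prime are functions, which become numbers only in the product with an
  MDS code.\<close>

definition typed_code :: "nat \<Rightarrow> nat \<Rightarrow> nat set set \<Rightarrow> (nat \<Rightarrow> 'a) set \<Rightarrow> bool" where
  "typed_code n t F C \<longleftrightarrow> (\<forall>x\<in>C. \<exists>\<pi>. \<pi> permutes {1..n} \<and>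
     (\<forall>y\<in>C. y \<noteq> x \<longrightarrow> card {i\<in>{1..n}. y i = x i} \<le> t \<and>
        (card {i\<in>{1..n}. y i = x i} = t \<longrightarrow> {i\<in>{1..n}. y i = x i} \<in> (`) \<pi> ` F)))"

text \<open>Symbols are paired with those of an MDS code. Words from different words of
  \<open>C\<close> have agreement sets inside the old ones, and a t-subset of an old agreement set
  is all of it; words from the same word agree in fewer than t places. The ratio of the size to the
  t-th power of \<open>card Sym * N\<close> is that of the old code.\<close>

lemma typed_code_blow_up:
  fixes C :: "(nat \<Rightarrow> 'a) set"
  assumes C: "typed_code n t F C" "C \<subseteq> {1..n} \<rightarrow>\<^sub>E Sym" and Sym: "finite Sym" "card Sym * N \<le> q"
    and N: "coprime N (fact n)" "N \<ge> 1" and t: "1 \<le> t" "t \<le> n"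
  shows "\<exists>C'. C' \<subseteq> {1..n} \<rightarrow>\<^sub>E {1..q::nat} \<and> typed_code n t F C' \<and> card C' = card C * N ^ t"
proof -
  obtain V where V: "V \<subseteq> {1..n} \<rightarrow>\<^sub>E {..<N}" "card V = N ^ t"
    "\<forall>u\<in>V. \<forall>v\<in>V. u \<noteq> v \<longrightarrow> card {i\<in>{1..n}. v i = u i} < t"
    using exists_mds_code[OF N t] by blast
  have "card (Sym \<times> {..<N}) \<le> card {1..q}" using Sym by (simp add: card_cartesian_product)
  moreover have "finite (Sym \<times> {..<N})" using Sym by simp
  ultimately obtain enc where enc: "enc ` (Sym \<times> {..<N}) \<subseteq> {1..q}" "inj_on enc (Sym \<times> {..<N})"
    using card_le_inj[of "Sym \<times> {..<N}" "{1..q}"] finite_atLeastAtMost by blast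
  define g where "g = (\<lambda>(x, v). \<lambda>i\<in>{1..n}. enc (x i, v i))"
  have mem: "(x i, v i) \<in> Sym \<times> {..<N}" if "x \<in> C" "v \<in> V" "i \<in> {1..n}" for x v i
    using that C(2) V(1) by blast
  have g_eq: "g (x, v) i = g (y, u) i \<longleftrightarrow> x i = y i \<and> v i = u i"
    if "x \<in> C" "v \<in> V" "y \<in> C" "u \<in> V" "i \<in> {1..n}" for x v y u i
    using inj_on_eq_iff[OF enc(2) mem[OF that(1,2,5)] mem[OF that(3,4,5)]] that(5) by (simp add: g_def)
  have inj: "inj_on g (C \<times> V)"
  proof (rule inj_onI, clarify)
    fix x v y u assume xv: "x \<in> C" "v \<in> V" "y \<in> C" "u \<in> V" "g (x, v) = g (y, u)"
    then have eq: "x i = y i \<and> v i = u i" if "i \<in> {1..n}" for i using g_eq[OF xv(1-4) that] by simp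
    have "x = y" using eq xv C(2) by (intro PiE_ext[of x "{1..n}" "\<lambda>_. Sym" y]) blast+
    moreover have "v = u" using eq xv V(1) by (intro PiE_ext[of v "{1..n}" "\<lambda>_. {..<N}" u]) blast+
    ultimately show "x = y \<and> v = u" by blast
  qed
  have sub: "g ` (C \<times> V) \<subseteq> {1..n} \<rightarrow>\<^sub>E {1..q}"
  proof (rule image_subsetI, clarify)
    fix x v assume xv: "x \<in> C" "v \<in> V"
    show "g (x, v) \<in> {1..n} \<rightarrow>\<^sub>E {1..q}"
      unfolding g_def prod.case restrict_PiE_iff using enc(1) mem[OF xv] by blast
  qed
  have "card (g ` (C \<times> V)) = card C * N ^ t"
    using card_image[OF inj] V(2) by (simp add: card_cartesian_product)
  moreover have "typed_code n t F (g ` (C \<times> V))"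
    unfolding typed_code_def
  proof (rule ballI)
    fix z assume "z \<in> g ` (C \<times> V)"
    then obtain x v where z: "z = g (x, v)" and x: "x \<in> C" and v: "v \<in> V" by blast
    obtain \<pi> where \<pi>: "\<pi> permutes {1..n}" and
      ag: "\<forall>y\<in>C. y \<noteq> x \<longrightarrow> card {i\<in>{1..n}. y i = x i} \<le> t \<and>
        (card {i\<in>{1..n}. y i = x i} = t \<longrightarrow> {i\<in>{1..n}. y i = x i} \<in> (`) \<pi> ` F)"
      using bspec[OF C(1)[unfolded typed_code_def] x] by blast
    show "\<exists>\<pi>. \<pi> permutes {1..n} \<and> (\<forall>z'\<in>g ` (C \<times> V). z' \<noteq> z \<longrightarrow> card {i\<in>{1..n}. z' i = z i} \<le> t \<and>
        (card {i\<in>{1..n}. z' i = z i} = t \<longrightarrow> {i\<in>{1..n}. z' i = z i} \<in> (`) \<pi> ` F))"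
    proof (intro exI[of _ \<pi>] conjI[OF \<pi>] ballI impI)
      fix z' assume "z' \<in> g ` (C \<times> V)" "z' \<noteq> z"
      then obtain y u where z': "z' = g (y, u)" and y: "y \<in> C" and u: "u \<in> V" by blast
      let ?A = "{i\<in>{1..n}. z' i = z i}"
      have A: "?A = {i\<in>{1..n}. y i = x i} \<inter> {i\<in>{1..n}. u i = v i}"
        using g_eq[OF y u x v] unfolding z z' by blast
      show "card ?A \<le> t \<and> (card ?A = t \<longrightarrow> ?A \<in> (`) \<pi> ` F)"
      proof (cases "y = x")
        case True
        then have "v \<noteq> u" using \<open>z' \<noteq> z\<close> z z' by blast
        then have "card {i\<in>{1..n}. u i = v i} < t" by (rule V(3)[THEN bspec, OF v, THEN bspec, OF u, THEN mp])
        moreover have "card ?A \<le> card {i\<in>{1..n}. u i = v i}" unfolding A by (intro card_mono) auto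
        ultimately show ?thesis by linarith
      next
        case False
        let ?B = "{i\<in>{1..n}. y i = x i}"
        have B: "card ?B \<le> t" "card ?B = t \<longrightarrow> ?B \<in> (`) \<pi> ` F"
          using ag[THEN bspec, OF y, THEN mp, OF False] by (rule conjunct1, rule conjunct2)
        have AB: "?A \<subseteq> ?B" unfolding A by blast
        have finB: "finite ?B" by simp
        have le: "card ?A \<le> card ?B" by (rule card_mono[OF finB AB])
        have "?A \<in> (`) \<pi> ` F" if "card ?A = t"
        proof -
          have "card ?B = t" using le B(1) that by linarith
          moreover have "?A = ?B" using that calculation by (intro card_subset_eq[OF finB AB]) linarith
          ultimately show ?thesis using B(2) by (simp only: simp_thms)
        qed
        then show ?thesis using le B(1) by linarith
      qed
    qed
  qed
  ultimately show ?thesis using sub by blast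
qed

section \<open>Codes typed by permutations\<close>

lemma exists_permutation_image:
  assumes "T \<in> ksets n t" "T' \<in> ksets n t"
  shows "\<exists>\<sigma>. \<sigma> permutes {1..n} \<and> \<sigma> ` T = T'"
proof -
  have T: "T \<subseteq> {1..n}" "T' \<subseteq> {1..n}" "card T = card T'" using assms by simp_all
  then have fin: "finite T" "finite T'" by (auto intro: finite_subset)
  obtain f where f: "bij_betw f T T'" using finite_same_card_bij[OF fin T(3)] by blast
  have "card ({1..n} - T) = card ({1..n} - T')" using T fin by (simp add: card_Diff_subset)
  then obtain g where g: "bij_betw g ({1..n} - T) ({1..n} - T')"
    using finite_same_card_bij[of "{1..n} - T" "{1..n} - T'"] by auto
  define \<sigma> where "\<sigma> i = (if i \<in> T then f i else if i \<in> {1..n} then g i else i)" for i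
  have 1: "bij_betw \<sigma> T T'" using f by (rule bij_betw_cong[THEN iffD1, rotated]) (simp add: \<sigma>_def)
  have 2: "bij_betw \<sigma> ({1..n} - T) ({1..n} - T')"
    using g by (rule bij_betw_cong[THEN iffD1, rotated]) (simp add: \<sigma>_def)
  have "bij_betw \<sigma> (T \<union> ({1..n} - T)) (T' \<union> ({1..n} - T'))"
    using 1 2 by (rule bij_betw_combine) blast
  moreover have "T \<union> ({1..n} - T) = {1..n}" "T' \<union> ({1..n} - T') = {1..n}" using T by blast+
  ultimately have "bij_betw \<sigma> {1..n} {1..n}" by (simp only:)
  moreover have "\<sigma> i = i" if "i \<notin> {1..n}" for i using that T(1) unfolding \<sigma>_def by auto
  ultimately have "\<sigma> permutes {1..n}" by (rule bij_imp_permutes)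
  moreover have "\<sigma> ` T = T'" using 1 by (rule bij_betw_imp_surj_on)
  ultimately show ?thesis by blast
qed

lemma permutes_image_ksets:
  assumes "\<pi> permutes {1..n}" "G \<subseteq> ksets n t"
  shows "(`) \<pi> ` G \<subseteq> ksets n t" and "card ((`) \<pi> ` G) = card G"
proof -
  have inj: "inj \<pi>" using assms(1) permutes_inj by blast
  show "(`) \<pi> ` G \<subseteq> ksets n t"
  proof (rule image_subsetI)
    fix A assume "A \<in> G"
    then have A: "A \<subseteq> {1..n}" "card A = t" using assms(2) by blast+
    have "\<pi> ` A \<subseteq> {1..n}" using image_mono[OF A(1), of \<pi>] permutes_image[OF assms(1)] by simp
    moreover have "card (\<pi> ` A) = t" using A(2) card_image[OF inj_on_subset[OF inj subset_UNIV]] by simp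
    ultimately show "\<pi> ` A \<in> ksets n t" by simp
  qed
  have "inj_on ((`) \<pi>) G" using inj by (auto simp: inj_on_def inj_image_eq_iff)
  then show "card ((`) \<pi> ` G) = card G" by (rule card_image)
qed

text \<open>Double counting of pairs of a permutation and a t-set. Composition with a permutation
  moving T to T' shows that all t-sets are covered equally often, so each count equals the
  average.\<close>

lemma card_permutations_covering:
  assumes G: "G \<subseteq> ksets n t" and T: "T \<in> ksets n t"
  shows "card {\<pi>. \<pi> permutes {1..n} \<and> T \<in> (`) \<pi> ` G} * (n choose t) = fact n * card G"
proof -
  define P where "P = {\<pi>. \<pi> permutes {1..n}}"
  have P: "finite P" "card P = fact n"
    using finite_permutations[of "{1..n}"] card_permutations[of "{1..n}" n] by (simp_all add: P_def)
  define r where "r T = card {\<pi>\<in>P. T \<in> (`) \<pi> ` G}" for T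
  have le: "r T \<le> r T'" if TT: "T \<in> ksets n t" "T' \<in> ksets n t" for T T'
  proof -
    obtain \<sigma> where \<sigma>: "\<sigma> permutes {1..n}" "\<sigma> ` T = T'" using exists_permutation_image[OF TT] by blast
    show ?thesis unfolding r_def
    proof (rule card_inj_on_le[where f = "(\<circ>) \<sigma>"])
      show "finite {\<pi>\<in>P. T' \<in> (`) \<pi> ` G}" using P by simp
      show "inj_on ((\<circ>) \<sigma>) {\<pi>\<in>P. T \<in> (`) \<pi> ` G}"
      proof (rule inj_onI)
        fix \<pi> \<rho> assume "\<sigma> \<circ> \<pi> = \<sigma> \<circ> \<rho>"
        then show "\<pi> = \<rho>"
          using permutes_inj[OF \<sigma>(1)] by (intro ext) (metis comp_apply injD)
      qed
      show "(\<circ>) \<sigma> ` {\<pi>\<in>P. T \<in> (`) \<pi> ` G} \<subseteq> {\<pi>\<in>P. T' \<in> (`) \<pi> ` G}"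
      proof (rule image_subsetI)
        fix \<pi> assume "\<pi> \<in> {\<pi>\<in>P. T \<in> (`) \<pi> ` G}"
        then obtain A where A: "\<pi> permutes {1..n}" "A \<in> G" "T = \<pi> ` A" unfolding P_def by blast
        have "\<sigma> \<circ> \<pi> permutes {1..n}" using A(1) \<sigma>(1) by (rule permutes_compose)
        moreover have "T' = (\<sigma> \<circ> \<pi>) ` A" using \<sigma>(2) A(3) by (simp only: image_comp)
        moreover note A(2)
        ultimately show "\<sigma> \<circ> \<pi> \<in> {\<pi>\<in>P. T' \<in> (`) \<pi> ` G}" unfolding P_def by blast
      qed
    qed
  qed
  have "r T * (n choose t) = (\<Sum>T'\<in>ksets n t. r T)" by (simp only: sum_constant card_ksets of_nat_id mult.commute)
  also have "\<dots> = (\<Sum>T'\<in>ksets n t. r T')"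
    using le T by (intro sum.cong refl antisym) blast+
  also have "\<dots> = (\<Sum>T'\<in>ksets n t. \<Sum>\<pi>\<in>P. if T' \<in> (`) \<pi> ` G then 1 else 0)"
    unfolding r_def using P(1) by (simp add: sum.If_cases Int_def)
  also have "\<dots> = (\<Sum>\<pi>\<in>P. \<Sum>T'\<in>ksets n t. if T' \<in> (`) \<pi> ` G then 1 else 0)" by (rule sum.swap)
  also have "\<dots> = (\<Sum>\<pi>\<in>P. card G)"
  proof (rule sum.cong[OF refl])
    fix \<pi> assume "\<pi> \<in> P"
    then have \<pi>: "\<pi> permutes {1..n}" by (simp add: P_def)
    have "(\<Sum>T'\<in>ksets n t. if T' \<in> (`) \<pi> ` G then 1 else 0) = card (ksets n t \<inter> (`) \<pi> ` G)"
      using finite_ksets[of n t] by (simp add: sum.If_cases Int_def)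
    also have "ksets n t \<inter> (`) \<pi> ` G = (`) \<pi> ` G" using permutes_image_ksets(1)[OF \<pi> G] by blast
    finally show "(\<Sum>T'\<in>ksets n t. if T' \<in> (`) \<pi> ` G then 1 else 0) = card G"
      using permutes_image_ksets(2)[OF \<pi> G] by simp
  qed
  also have "\<dots> = fact n * card G" using P(2) by simp
  finally show ?thesis by (simp add: r_def P_def)
qed

text \<open>The own sets of type \<open>\<pi>\<close> are the images under \<open>\<pi>\<close> of
  the t-sets outside F, and R is the number of types owning a given t-set. The main term has density
  n! * L / p, which is close to n! / R when L is close to p / R.\<close>

lemma exists_typed_code_over_prime:
  fixes n t p L R :: nat
  assumes t: "1 \<le> t" "t \<le> n" and F: "F \<subseteq> ksets n t" "card F < n choose t"
    and R: "R * (n choose t) = fact n * ((n choose t) - card F)"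
    and big: "prime p" "(n choose t) + (n choose (t + 1)) < p" "L * R < p"
  shows "\<exists>(C :: (nat \<Rightarrow> nat set \<Rightarrow> int) set) Sym. finite Sym \<and> card Sym = p ^ (n choose t) \<and>
    C \<subseteq> {1..n} \<rightarrow>\<^sub>E Sym \<and> typed_code n t F C \<and>
    fact n * (L * p ^ ((n choose t) * t)) \<le>
      p * card C + fact n * (fact n * (n choose (t + 1)) * p ^ ((n choose t) * t))"
proof -
  interpret labelled_words n t p by unfold_locales (use t big in auto)
  define P where "P = {\<pi>. \<pi> permutes {1..n}}"
  have P: "finite P" "card P = fact n"
    using finite_permutations[of "{1..n}"] card_permutations[of "{1..n}" n] by (simp_all add: P_def)
  define G where "G = ksets n t - F"
  have G: "G \<subseteq> ksets n t" by (auto simp: G_def)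
  have finF: "finite F" using F(1) finite_ksets[of n t] by (rule finite_subset)
  have cG: "card G = (n choose t) - card F"
    unfolding G_def using card_Diff_subset[OF finF F(1)] by (simp only: card_ksets)
  then have "G \<noteq> {}" using F(2) by force
  have perm: "\<pi> permutes {1..n}" if "\<pi> \<in> P" for \<pi> using that by (simp add: P_def)
  have cnt: "card {\<pi>\<in>P. T \<in> (`) \<pi> ` G} = R" if "T \<in> TT" for T
  proof -
    have "card {\<pi>. \<pi> permutes {1..n} \<and> T \<in> (`) \<pi> ` G} * (n choose t) = R * (n choose t)"
      using card_permutations_covering[OF G that[unfolded TT_def]] R cG by simp
    then have "card {\<pi>. \<pi> permutes {1..n} \<and> T \<in> (`) \<pi> ` G} = R" using t(2) by simp
    then show ?thesis by (simp add: P_def)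
  qed
  have "\<exists>D. (\<forall>\<pi>\<in>P. D \<pi> \<subseteq> X \<and>
        L * p ^ (k * t) \<le> p * card (D \<pi>) + card P * (n choose (t + 1)) * p ^ (k * t)) \<and>
      (\<forall>\<pi>\<in>P. \<forall>\<sigma>\<in>P. \<forall>x\<in>D \<pi>. \<forall>y\<in>D \<sigma>.
        (\<exists>S\<in>(`) \<pi> ` G \<union> ksets n (t + 1). agree x y S) \<longrightarrow> \<pi> = \<sigma> \<and> x = y)"
  proof (rule exists_typed_code)
    show "(`) \<pi> ` G \<subseteq> TT" if "\<pi> \<in> P" for \<pi>
      unfolding TT_def by (rule permutes_image_ksets(1)[OF perm[OF that] G])
    show "(`) \<pi> ` G \<noteq> {}" for \<pi> using \<open>G \<noteq> {}\<close> by simp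
    show "k + (n choose (t + 1)) < p" using big(2) by (simp only: k_def)
  qed (use P cnt big in auto)
  then obtain D where D: "\<forall>\<pi>\<in>P. D \<pi> \<subseteq> X \<and>
        L * p ^ (k * t) \<le> p * card (D \<pi>) + card P * (n choose (t + 1)) * p ^ (k * t)"
    and sep: "\<forall>\<pi>\<in>P. \<forall>\<sigma>\<in>P. \<forall>x\<in>D \<pi>. \<forall>y\<in>D \<sigma>.
        (\<exists>S\<in>(`) \<pi> ` G \<union> ksets n (t + 1). agree x y S) \<longrightarrow> \<pi> = \<sigma> \<and> x = y"
    by (elim exE conjE)
  have sepD: "\<pi> = \<sigma> \<and> x = y"
    if "\<pi> \<in> P" "\<sigma> \<in> P" "x \<in> D \<pi>" "y \<in> D \<sigma>" "S \<in> (`) \<pi> ` G \<union> ksets n (t + 1)" "agree x y S"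
    for \<pi> \<sigma> x y S
    by (rule sep[THEN bspec, OF that(1), THEN bspec, OF that(2), THEN bspec, OF that(3),
          THEN bspec, OF that(4), THEN mp, OF bexI, OF that(6,5)])
  define U where "U = (\<Union>\<pi>\<in>P. D \<pi>)"
  have UX: "U \<subseteq> X" using D unfolding U_def by blast
  have cardU: "card U = (\<Sum>\<pi>\<in>P. card (D \<pi>))" unfolding U_def
  proof (rule card_UN_disjoint[OF P(1)])
    show "\<forall>\<pi>\<in>P. finite (D \<pi>)" using D finite_X finite_subset by blast
    show "\<forall>\<pi>\<in>P. \<forall>\<sigma>\<in>P. \<pi> \<noteq> \<sigma> \<longrightarrow> D \<pi> \<inter> D \<sigma> = {}"
    proof (intro ballI impI, rule ccontr)
      fix \<pi> \<sigma> assume ps: "\<pi> \<in> P" "\<sigma> \<in> P" "\<pi> \<noteq> \<sigma>" "D \<pi> \<inter> D \<sigma> \<noteq> {}"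
      then obtain x where x: "x \<in> D \<pi>" "x \<in> D \<sigma>" by blast
      \<comment> \<open>A word agrees with itself on an own set, so the separation property forbids
        it to have two types.\<close>
      obtain A where "A \<in> G" using \<open>G \<noteq> {}\<close> by blast
      then have "\<pi> ` A \<in> (`) \<pi> ` G \<union> ksets n (t + 1)" by blast
      moreover have "agree x x (\<pi> ` A)" by (simp add: agree_def)
      ultimately show False using sepD[OF ps(1,2) x] ps(3) by blast
    qed
  qed
  define Sym where "Sym = TT \<rightarrow>\<^sub>E {0..<int p}"
  \<comment> \<open>Currying turns the flat words into words over {1..n} whose symbols are vectors
    indexed by t-sets.\<close>
  define conv where "conv x = (\<lambda>i\<in>{1..n}. \<lambda>T\<in>TT. x (i, T))" for x :: "nat \<times> nat set \<Rightarrow> int"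
  have conv_eq: "conv x i = conv y i \<longleftrightarrow> (\<forall>T\<in>TT. x (i, T) = y (i, T))" if "i \<in> {1..n}" for x y i
  proof
    assume "conv x i = conv y i"
    then have "(\<lambda>T\<in>TT. x (i, T)) = (\<lambda>T\<in>TT. y (i, T))" using that by (simp add: conv_def)
    then show "\<forall>T\<in>TT. x (i, T) = y (i, T)" by (metis restrict_apply')
  next
    assume "\<forall>T\<in>TT. x (i, T) = y (i, T)"
    then have "(\<lambda>T\<in>TT. x (i, T)) = (\<lambda>T\<in>TT. y (i, T))" by (intro restrict_ext) blast
    then show "conv x i = conv y i" using that by (simp add: conv_def)
  qed
  have agree_conv: "agree x y S" if "S \<subseteq> {i\<in>{1..n}. conv y i = conv x i}" for x y S
    unfolding agree_def
  proof
    fix i assume "i \<in> S"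
    then have "i \<in> {1..n}" "conv x i = conv y i" using that by auto
    then show "\<forall>T\<in>TT. x (i, T) = y (i, T)" using conv_eq by blast
  qed
  have inj: "inj_on conv U"
  proof (rule inj_onI)
    fix x y assume xy: "x \<in> U" "y \<in> U" "conv x = conv y"
    have "x i = y i" if "i \<in> I" for i
      using conv_eq[of "fst i" x y] xy(3) that by (auto simp: I_def)
    then show "x = y" using xy UX unfolding X_def by (intro PiE_ext[of x I "\<lambda>_. {0..<int p}" y]) blast+
  qed
  have "fact n * (L * p ^ (k * t)) = (\<Sum>\<pi>\<in>P. L * p ^ (k * t))" using P(2) by simp
  also have "\<dots> \<le> (\<Sum>\<pi>\<in>P. p * card (D \<pi>) + card P * (n choose (t + 1)) * p ^ (k * t))"
    using D by (intro sum_mono) blast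
  also have "\<dots> = p * card (conv ` U) + fact n * (fact n * (n choose (t + 1)) * p ^ (k * t))"
    using P(2) by (simp add: sum.distrib card_image[OF inj] cardU sum_distrib_left)
  finally have size: "fact n * (L * p ^ (k * t)) \<le>
     p * card (conv ` U) + fact n * (fact n * (n choose (t + 1)) * p ^ (k * t))" .
  have Sym: "finite Sym" "card Sym = p ^ k"
    using finite_TT card_TT by (simp_all add: Sym_def finite_PiE card_PiE)
  have conv_sub: "conv ` U \<subseteq> {1..n} \<rightarrow>\<^sub>E Sym"
  proof (rule image_subsetI)
    fix x assume "x \<in> U"
    then have x: "x \<in> I \<rightarrow>\<^sub>E {0..<int p}" using UX unfolding X_def by blast
    have "x (i, T) \<in> {0..<int p}" if "i \<in> {1..n}" "T \<in> TT" for i T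
      using that by (intro PiE_mem[OF x]) (simp add: I_def)
    then show "conv x \<in> {1..n} \<rightarrow>\<^sub>E Sym" unfolding conv_def Sym_def restrict_PiE_iff by blast
  qed
  have typed: "typed_code n t F (conv ` U)" unfolding typed_code_def
  proof (rule ballI)
    fix z assume "z \<in> conv ` U"
    then obtain x \<pi> where z: "z = conv x" and \<pi>: "\<pi> \<in> P" and x: "x \<in> D \<pi>" unfolding U_def by blast
    show "\<exists>\<pi>. \<pi> permutes {1..n} \<and> (\<forall>z'\<in>conv ` U. z' \<noteq> z \<longrightarrow> card {i\<in>{1..n}. z' i = z i} \<le> t \<and>
        (card {i\<in>{1..n}. z' i = z i} = t \<longrightarrow> {i\<in>{1..n}. z' i = z i} \<in> (`) \<pi> ` F))"
    proof (intro exI[of _ \<pi>] conjI[OF perm[OF \<pi>]] ballI impI)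
      fix z' assume "z' \<in> conv ` U" "z' \<noteq> z"
      then obtain y \<sigma> where z': "z' = conv y" and \<sigma>: "\<sigma> \<in> P" and y: "y \<in> D \<sigma>" unfolding U_def by blast
      let ?A = "{i\<in>{1..n}. z' i = z i}"
      have ne: "x \<noteq> y" using \<open>z' \<noteq> z\<close> z z' by blast
      have no: False if "S \<subseteq> ?A" "S \<in> (`) \<pi> ` G \<union> ksets n (t + 1)" for S
        using sepD[OF \<pi> \<sigma> x y that(2)] agree_conv[of S y x] that(1) ne unfolding z z' by blast
      have A1: "?A \<subseteq> {1..n}" by blast
      have "card ?A \<le> t"
      proof (rule ccontr)
        assume "\<not> card ?A \<le> t"
        then have "t + 1 \<le> card ?A" by linarith
        then obtain S where S: "S \<subseteq> ?A" "card S = t + 1" by (rule obtain_subset_with_card_n)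
        then have "S \<in> ksets n (t + 1)" using A1 by blast
        then show False using no[OF S(1)] by blast
      qed
      moreover have "?A \<in> (`) \<pi> ` F" if c: "card ?A = t"
      proof -
        define A' where "A' = inv \<pi> ` ?A"
        have A'_in: "A' \<in> ksets n t"
          using permutes_image_ksets(1)[OF permutes_inv[OF perm[OF \<pi>]], of "{?A}" t] A1 c
          unfolding A'_def by blast
        have A'_image: "\<pi> ` A' = ?A"
          using permutes_surj[OF perm[OF \<pi>]] unfolding A'_def by (rule image_f_inv_f)
        have "A' \<notin> G"
        proof
          assume "A' \<in> G"
          then have "?A \<in> (`) \<pi> ` G \<union> ksets n (t + 1)" using A'_image by blast
          then show False using no[of ?A] by blast
        qed
        with A'_in have "A' \<in> F" unfolding G_def by (metis DiffI)
        then have "\<pi> ` A' \<in> (`) \<pi> ` F" by (rule imageI)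
        then show ?thesis by (simp only: A'_image)
      qed
      ultimately show "card ?A \<le> t \<and> (card ?A = t \<longrightarrow> ?A \<in> (`) \<pi> ` F)" by blast
    qed
  qed
  show ?thesis
    by (intro exI[of _ "conv ` U"] exI[of _ Sym] conjI Sym(1) conv_sub typed
        Sym(2)[unfolded k_def] size[unfolded k_def])
qed

lemma frameproof_of_typed_code:
  assumes C: "typed_code n t F C" and F: "matching_free n l (s + 1) (c - s + 1) F"
    and par: "s * n = c * (t - 1) + l" "1 \<le> s" "s \<le> c" "l \<in> {1..c}" "t \<ge> 1"
  shows "frameproof c s n C"
proof (rule frameproof_of_small_agreement[OF _ par])
  fix x assume x: "x \<in> C"
  obtain \<pi> where \<pi>: "\<pi> permutes {1..n}" and
    ag: "\<forall>y\<in>C. y \<noteq> x \<longrightarrow> card {i\<in>{1..n}. y i = x i} \<le> t \<and>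
      (card {i\<in>{1..n}. y i = x i} = t \<longrightarrow> {i\<in>{1..n}. y i = x i} \<in> (`) \<pi> ` F)"
    using bspec[OF C[unfolded typed_code_def] x] by blast
  have "matching_free n l (s + 1) (c - s + 1) ((`) \<pi> ` F)"
    using matching_free_permute[OF F \<pi>] by simp
  then show "\<exists>F. matching_free n l (s + 1) (c - s + 1) F \<and>
      (\<forall>y\<in>C. y \<noteq> x \<longrightarrow> card {i\<in>{1..n}. y i = x i} \<le> t \<and>
        (card {i\<in>{1..n}. y i = x i} = t \<longrightarrow> {i\<in>{1..n}. y i = x i} \<in> F))"
    using ag by (intro exI[of _ "(`) \<pi> ` F"] conjI)
qed

section \<open>The limit\<close>

text \<open>One code over a fixed alphabet settles all large q: products with MDS codes keep its
  ratio, and the effect of rounding q / Q to an admissible N vanishes in the limit.\<close>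

lemma eventually_max_frameproof_gt:
  fixes C :: "(nat \<Rightarrow> 'a) set" and b :: real
  assumes C: "typed_code n t F C" "C \<subseteq> {1..n} \<rightarrow>\<^sub>E Sym" and Sym: "finite Sym" "card Sym \<ge> 1"
    and F: "matching_free n l (s + 1) (c - s + 1) F"
    and par: "s * n = c * (t - 1) + l" "1 \<le> s" "s \<le> c" "l \<in> {1..c}" "t \<ge> 1" "t \<le> n"
    and b: "b < real (card C) / real (card Sym) ^ t"
  shows "eventually (\<lambda>q. b < real (max_frameproof q c s n) / real q ^ t) sequentially"
proof -
  define Q where "Q = card Sym"
  define f :: nat where "f = fact n"
  \<comment> \<open>For q at least Q this is the largest number congruent to 1 mod n! that does not
    exceed q div Q; the congruence makes it coprime to n!.\<close>
  define N where "N q = (q div Q - 1) div f * f + 1" for q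
  have Q: "Q \<ge> 1" and f: "f \<ge> 1" using Sym by (simp_all add: Q_def f_def)
  have ge: "real (card C) * (real (N q) / real q) ^ t \<le> real (max_frameproof q c s n) / real q ^ t"
    if q: "Q \<le> q" for q
  proof -
    have "1 \<le> q div Q" using q Q by (simp add: Suc_le_eq div_greater_zero_iff)
    moreover have "(q div Q - 1) div f * f \<le> q div Q - 1" by simp
    ultimately have "N q \<le> q div Q" unfolding N_def by linarith
    then have "Q * N q \<le> q" by (metis mult.commute div_times_less_eq_dividend mult_le_mono2 le_trans)
    moreover have "coprime (N q) (fact n)"
    proof -
      have "x dvd 1" if "x dvd N q" "x dvd f" for x
        using that unfolding N_def by (metis dvd_add_right_iff dvd_mult)
      then have "coprime (N q) f" by (rule coprimeI) simp_all
      then show ?thesis by (simp only: f_def)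
    qed
    moreover have "1 \<le> N q" by (simp add: N_def)
    ultimately obtain C' where C': "C' \<subseteq> {1..n} \<rightarrow>\<^sub>E {1..q}" "typed_code n t F C'" "card C' = card C * N q ^ t"
      using typed_code_blow_up[OF C Sym(1) _ _ _ par(5,6), of "N q" q] unfolding Q_def by blast
    have "card C' \<le> max_frameproof q c s n"
      using C'(1) frameproof_of_typed_code[OF C'(2) F par(1-5)] unfolding words_def[symmetric]
      by (rule max_frameproof_ge)
    then have "real (card C * N q ^ t) \<le> real (max_frameproof q c s n)"
      using C'(3) by (simp only: of_nat_le_iff)
    then show ?thesis by (simp add: power_divide divide_right_mono)
  qed
  have lim: "(\<lambda>q. real (N q) / real q) \<longlonglongrightarrow> 1 / real Q"
  proof (rule real_tendsto_sandwich)
    show "eventually (\<lambda>q. 1 / real Q - (1 + real f) / real q \<le> real (N q) / real q) sequentially"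
      using eventually_gt_at_top[of 0]
    proof eventually_elim
      case (elim q)
      have "q div Q - 1 < ((q div Q - 1) div f + 1) * f"
        using f by (simp add: dividend_less_times_div[of f, simplified] mult.commute)
      then have "q div Q < N q + f + 1" by (simp add: N_def)
      moreover have "q < (q div Q + 1) * Q"
        using dividend_less_div_times[of Q q] Q by simp
      ultimately have "q \<le> (N q + f + 1) * Q"
        by (metis Suc_eq_plus1 Suc_leI le_trans less_imp_le mult_le_mono1)
      then have "real q \<le> (real (N q) + real f + 1) * real Q"
        by (metis of_nat_1 of_nat_add of_nat_le_iff of_nat_mult)
      then have "real q / real Q \<le> real (N q) + real f + 1"
        using Q by (simp add: pos_divide_le_eq)
      then have "real q / real Q / real q \<le> (real (N q) + real f + 1) / real q"
        by (rule divide_right_mono) simp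
      then show ?case using elim by (simp add: add_divide_distrib)
    qed
    show "eventually (\<lambda>q. real (N q) / real q \<le> 1 / real Q) sequentially"
      using eventually_ge_at_top[of Q]
    proof eventually_elim
      case (elim q)
      have "1 \<le> q div Q" using elim Q by (simp add: Suc_le_eq div_greater_zero_iff)
      moreover have "(q div Q - 1) div f * f \<le> q div Q - 1" by simp
      ultimately have "N q \<le> q div Q" unfolding N_def by linarith
      then have "N q * Q \<le> q" by (metis div_times_less_eq_dividend mult_le_mono1 le_trans)
      then have "real (N q) * real Q \<le> real q" by (metis of_nat_le_iff of_nat_mult)
      then show ?case using elim Q by (simp add: field_simps)
    qed
    show "(\<lambda>q. 1 / real Q - (1 + real f) / real q) \<longlonglongrightarrow> 1 / real Q"
      using tendsto_diff[OF tendsto_const lim_const_over_n[of "1 + real f"], of "1 / real Q"] by simp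
  qed simp
  have "(\<lambda>q. real (card C) * (real (N q) / real q) ^ t) \<longlonglongrightarrow> real (card C) * (1 / real Q) ^ t"
    by (intro tendsto_mult tendsto_power lim tendsto_const)
  moreover have "b < real (card C) * (1 / real Q) ^ t" using b by (simp add: Q_def power_divide)
  ultimately have "eventually (\<lambda>q. b < real (card C) * (real (N q) / real q) ^ t) sequentially"
    by (rule order_tendstoD(1))
  then show ?thesis using eventually_ge_at_top[of Q]
  proof eventually_elim
    case (elim q)
    then show ?case using ge[of q] by linarith
  qed
qed

text \<open>The ceiling says that s * n exceeds c * (t - 1) by a number in {1..c}. It is congruent
  to l, hence equal to l. The bound t \<le> n rests on s < c.\<close>

lemma mult_eq_of_ceiling_cong:
  fixes n c s t l :: nat
  assumes "n \<ge> 2" "c \<ge> 2" "1 \<le> s" "s \<le> c - 1"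
    and t: "int t = \<lceil>real (s * n) / real c\<rceil>"
    and l: "l \<in> {1..c}" "[l = s * n] (mod c)"
  shows "s * n = c * (t - 1) + l" "1 \<le> t" "t \<le> n"
proof -
  have c: "0 < real c" using assms by simp
  have "of_int (int t) - 1 < real (s * n) / real c \<and> real (s * n) / real c \<le> of_int (int t)"
    unfolding t by (rule ceiling_correct)
  then have "(real t - 1) * real c < real (s * n)" "real (s * n) \<le> real t * real c"
    using c by (simp_all add: field_simps)
  then have r: "real (t * c) < real (s * n + c)" "real (s * n) \<le> real (t * c)"
    by (simp_all add: algebra_simps)
  then have b: "t * c < s * n + c" "s * n \<le> t * c" by (simp_all only: of_nat_less_iff of_nat_le_iff)
  have sn: "1 \<le> s * n" using assms by simp
  then show t1: "1 \<le> t" using b(2) by (cases t) auto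
  then obtain u where u: "t = Suc u" by (cases t) auto
  have "s * n < c * n" using assms by simp
  moreover have "(n + 1) * c = c * n + c" by simp
  ultimately have "t * c < (n + 1) * c" using b(1) by linarith
  then have "t < n + 1" by (rule mult_right_less_imp_less) simp
  then show "t \<le> n" by simp
  define r where "r = s * n - c * u"
  have r1: "1 \<le> r" "r \<le> c" "s * n = c * u + r"
    using b unfolding u r_def by (simp_all add: mult.commute)
  have "[l = r] (mod c)" using l(2) unfolding r1(3) by (simp add: cong_def)
  then have "int c dvd int l - int r" by (simp add: cong_int_iff[symmetric] cong_iff_dvd_diff)
  \<comment> \<open>Both numbers lie in {1..c}; the shift by 1 moves them to the standard residues
    from 0 to c - 1.\<close>
  then have "int c dvd (int l - 1) - (int r - 1)" by simp
  then have "int l - 1 = int r - 1"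
    by (rule eq_of_dvd_diff) (use r1 l(1) in auto)
  then show "s * n = c * (t - 1) + l" using r1(3) u by simp
qed

theorem theorem1p2:
  fixes n c s t l :: nat
  assumes "n \<ge> 2" and "c \<ge> 2" and "1 \<le> s" and "s \<le> c - 1"
    and "int t = \<lceil>real (s * n) / real c\<rceil>"
    and "l \<in> {1..c}" and "[l = s * n] (mod c)"
  shows "(\<lambda>q::nat. real (max_frameproof q c s n) / real q ^ t)
           \<longlonglongrightarrow> real (n choose t) /
             (real (n choose t) - real (gen_matching_number n t l (s + 1) (c - s + 1)))"
proof -
  note eqs = mult_eq_of_ceiling_cong[OF assms]
  have sc: "s \<le> c" using assms(4) by simp
  note par = eqs(1) assms(3) sc assms(6) eqs(2)
  define m where "m = gen_matching_number n t l (s + 1) (c - s + 1)"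
  define M where "M = n choose t"
  define d where "d = M - m"
  have m: "m < M" unfolding m_def M_def
    by (rule gen_matching_number_less[OF assms(3) sc eqs(1) assms(6) eqs(2)])
  then have d: "0 < d" "real M - real m = real d" by (simp_all add: d_def)
  have "(\<lambda>q. real (max_frameproof q c s n) / real q ^ t) \<longlonglongrightarrow> real M / real d"
  proof (rule order_tendstoI)
    fix b :: real assume b: "real M / real d < b"
    \<comment> \<open>Division of the counting bound by d * q^t leaves the error K / q, caused by
      the words with an own (t-1)-set.\<close>
    define K where "K = n choose (t - 1)"
    have "(\<lambda>q. real M / real d + real K / real q) \<longlonglongrightarrow> real M / real d + 0"
      by (intro tendsto_add tendsto_const lim_const_over_n)
    then have "eventually (\<lambda>q. real M / real d + real K / real q < b) sequentially"
      using b by (intro order_tendstoD(2)) simp_all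
    then show "eventually (\<lambda>q. real (max_frameproof q c s n) / real q ^ t < b) sequentially"
      using eventually_gt_at_top[of 0]
    proof eventually_elim
      case (elim q)
      obtain C where C: "C \<subseteq> words q n" "frameproof c s n C" "card C = max_frameproof q c s n"
        by (rule max_frameproof_attained)
      have "card C * d \<le> M * q ^ t + d * (K * q ^ (t - 1))"
        unfolding d_def M_def m_def K_def by (rule card_frameproof_le[OF C(1,2) par])
      then have "real (card C * d) \<le> real (M * q ^ t + d * (K * q ^ (t - 1)))"
        by (simp only: of_nat_le_iff)
      then have "real (card C) * real d \<le> real M * real q ^ t + real d * (real K * real q ^ (t - 1))"
        by simp
      moreover have "real q ^ t = real q * real q ^ (t - 1)"
        using eqs(2) by (cases t) simp_all
      ultimately have "real (card C) / real q ^ t \<le> real M / real d + real K / real q"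
        using d(1) elim(2) by (simp add: field_simps)
      then show ?case using elim(1) C(3) by simp
    qed
  next
    fix b :: real assume b: "b < real M / real d"
    obtain F where F: "F \<subseteq> ksets n t" "matching_free n l (s + 1) (c - s + 1) F" "card F = m"
      using gen_matching_number_attained[of l n t "s + 1" "c - s + 1"] assms(6) unfolding m_def by auto
    define P :: nat where "P = fact n"
    define W where "W = n choose (t + 1)"
    obtain T where T: "T \<in> ksets n t"
      using m card_ksets[of n t] unfolding M_def by (metis card.empty ex_in_conv not_less_zero)
    define R where "R = card {\<pi>. \<pi> permutes {1..n} \<and> T \<in> (`) \<pi> ` (ksets n t - F)}"
    have finF: "finite F" using F(1) finite_ksets[of n t] by (rule finite_subset)
    have "card (ksets n t - F) = d"
      using card_Diff_subset[OF finF F(1)] F(3) unfolding d_def M_def by (simp only: card_ksets)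
    then have R: "R * M = P * d"
      using card_permutations_covering[of "ksets n t - F" n t T] T unfolding R_def M_def P_def by simp
    have "P > 0" by (simp add: P_def)
    then have "R * M > 0" using R d(1) by simp
    then have R0: "R > 0" by simp
    have PR: "real P / real R = real M / real d"
    proof -
      have "real R * real M = real P * real d" using R by (metis of_nat_mult)
      then show ?thesis using R0 d(1) by (simp add: field_simps)
    qed
    \<comment> \<open>A lower estimate for the density reached over the prime p: rounding L costs at
      most P / p and the deletions cost P * P * W / p, while the term P / R over p is slack.\<close>
    define h where "h p = real P / real R - (real P / real R + real P + real P * real P * real W) / real p" for p
    have "h \<longlonglongrightarrow> real P / real R - 0"
      unfolding h_def by (intro tendsto_diff tendsto_const lim_const_over_n)
    then have "eventually (\<lambda>p. b < h p) sequentially"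
      using b PR by (intro order_tendstoD(1)) simp_all
    then obtain p0 where p0: "\<And>p. p \<ge> p0 \<Longrightarrow> b < h p" by (auto simp: eventually_sequentially)
    \<comment> \<open>The prime depends on b alone and is fixed before q tends to infinity; M + W <
      p is the condition for the common hash.\<close>
    obtain p where p: "prime p" "p0 + M + W < p" using bigger_prime by blast
    \<comment> \<open>The largest length for which R intervals of labels fit beside the label
      0.\<close>
    define L where "L = (p - 1) div R"
    have "L * R \<le> p - 1" by (simp add: L_def)
    then have LR: "L * R < p" using p by simp
    have "R * M = fact n * (M - card F)" using R F(3) by (simp add: P_def d_def)
    then obtain C :: "(nat \<Rightarrow> nat set \<Rightarrow> int) set" and Sym where C: "finite Sym" "card Sym = p ^ M"
      "C \<subseteq> {1..n} \<rightarrow>\<^sub>E Sym" "typed_code n t F C"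
      "P * (L * p ^ (M * t)) \<le> p * card C + P * (P * W * p ^ (M * t))"
      using exists_typed_code_over_prime[OF eqs(2,3) F(1), of R p L] F(3) m p LR
      unfolding M_def P_def W_def by auto
    have "b < real (card C) / real (card Sym) ^ t"
    proof -
      define Z where "Z = real (p ^ (M * t))"
      have p1: "real p > 0" and Z: "Z > 0" using p prime_gt_0_nat by (simp_all add: Z_def)
      have "real (P * (L * p ^ (M * t))) \<le> real (p * card C + P * (P * W * p ^ (M * t)))"
        using C(5) by (simp only: of_nat_le_iff)
      then have 1: "real P * (real L * Z) \<le> real p * real (card C) + real P * (real P * real W * Z)"
        by (simp add: Z_def)
      have "p - 1 < (L + 1) * R"
        using dividend_less_div_times[of R "p - 1"] R0 by (simp add: L_def)
      then have "p \<le> (L + 1) * R" by linarith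
      then have "real p \<le> (real L + 1) * real R" by (metis of_nat_1 of_nat_add of_nat_le_iff of_nat_mult)
      then have "real p / real R \<le> real L + 1" using R0 by (simp add: field_simps)
      then have "real P * (real p / real R - 1) \<le> real P * real L" by (intro mult_left_mono) simp_all
      then have "real P * (real p / real R - 1) * Z \<le> real P * real L * Z"
        using Z by (intro mult_right_mono) simp_all
      then have 2: "(real P * (real p / real R - 1) - real P * real P * real W) * Z \<le> real p * real (card C)"
        using 1 by (simp add: algebra_simps)
      have "b < h p" using p0 p by simp
      also have "h p \<le> (real P * (real p / real R - 1) - real P * real P * real W) / real p"
        using p1 R0 by (simp add: h_def field_simps)
      also have "\<dots> \<le> real (card C) / Z" using 2 p1 Z by (simp add: field_simps)
      also have "Z = real (card Sym) ^ t" by (simp add: Z_def C(2) power_mult)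
      finally show ?thesis .
    qed
    moreover have "1 \<le> card Sym" using C(2) p prime_gt_0_nat by (simp add: Suc_le_eq)
    ultimately show "eventually (\<lambda>q. b < real (max_frameproof q c s n) / real q ^ t) sequentially"
      using eventually_max_frameproof_gt[OF C(4,3,1) _ F(2) par eqs(3)] by blast
  qed
  then show ?thesis using d(2) by (simp add: M_def m_def)
qed

end
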